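(* For a compact group $G$, the following conditions are equivalent: (i) every $G_\delta$-dense (equivalently, each dense pseudocompact) subgroup of $G$ is projectively Arhangel'skiĭ; (ii) all dense countably compact subgroups of $G$ are projectively Arhangel'skiĭ; (iii) $w(G)\le\mathfrak{c}$.
   Context: All spaces and topological groups are assumed to be Hausdorff. Compact groups are not assumed to be abelian. $w(X)$ denotes the weight of a space $X$ and $\mathfrak{c}$ is the cardinality of the continuum. A subgroup $D$ of a topological group $G$ is $G_\delta$-dense in $G$ if $D\cap B\neq\emptyset$ for every non-empty $G_\delta$-subset $B$ of $G$. A space is pseudocompact if every real-valued continuous function on it is bounded, and countably compact if every countable open cover of it has a finite subcover. (By a theorem of Comfort and Ross, a dense subgroup of a compact group is pseudocompact if and only if it is $G_\delta$-dense.) A space $X$ has the Arhangel'skiĭ property if $w(X)\le |X|$. A topological group $G$ is projectively Arhangel'skiĭ if every (Hausdorff) topological group that is the image of $G$ under a continuous surjective homomorphism has the Arhangel'skiĭ property. *)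

theory Defs
  imports "HOL-Analysis.Analysis" "HOL-Algebra.Group"
begin

unbundle cardinal_syntax

text \<open>Topological groups are Hausdorff by convention, and need not be abelian.\<close>

locale topological_group = group G for G (structure) +
  fixes T :: "'a topology"
  assumes topspace_eq: "topspace T = carrier G"
    and continuous_mult: "continuous_map (prod_topology T T) T (\<lambda>(x, y). x \<otimes> y)"
    and continuous_inv: "continuous_map T T (\<lambda>x. inv x)"
    and Hausdorff: "Hausdorff_space T"

definition dense_in :: "'a topology \<Rightarrow> 'a set \<Rightarrow> bool" where
  "dense_in X D \<longleftrightarrow> D \<subseteq> topspace X \<and> X closure_of D = topspace X"

definition gdelta_dense_in :: "'a topology \<Rightarrow> 'a set \<Rightarrow> bool" where
  "gdelta_dense_in X D \<longleftrightarrow>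
     D \<subseteq> topspace X \<and> (\<forall>B. gdelta_in X B \<and> B \<noteq> {} \<longrightarrow> D \<inter> B \<noteq> {})"

definition pseudocompact_space :: "'a topology \<Rightarrow> bool" where
  "pseudocompact_space X \<longleftrightarrow>
     (\<forall>f. continuous_map X euclideanreal f \<longrightarrow> bounded (f ` topspace X))"

definition countably_compact_space :: "'a topology \<Rightarrow> bool" where
  "countably_compact_space X \<longleftrightarrow>
     (\<forall>\<U>. countable \<U> \<and> (\<forall>U\<in>\<U>. openin X U) \<and> topspace X \<subseteq> \<Union>\<U> \<longrightarrow>
        (\<exists>\<F>. finite \<F> \<and> \<F> \<subseteq> \<U> \<and> topspace X \<subseteq> \<Union>\<F>))"

definition is_base :: "'a topology \<Rightarrow> 'a set set \<Rightarrow> bool" where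
  "is_base X \<B> \<longleftrightarrow>
     (\<forall>V\<in>\<B>. openin X V) \<and>
     (\<forall>U x. openin X U \<and> x \<in> U \<longrightarrow> (\<exists>V\<in>\<B>. x \<in> V \<and> V \<subseteq> U))"

text \<open>
  The weight is the least cardinality of a base, represented (like every cardinal in HOL) by a
  well-order that is determined up to \<open>=o\<close>. It is not rounded up to an infinite cardinal: a finite
  discrete space with \<open>n\<close> points has weight \<open>n\<close>.
\<close>

definition weight :: "'a topology \<Rightarrow> 'a set rel" where
  "weight X = |SOME \<B>. is_base X \<B> \<and> (\<forall>\<C>. is_base X \<C> \<longrightarrow> |\<B>| \<le>o |\<C>| )|"

definition arhangelskii :: "'a topology \<Rightarrow> bool" where
  "arhangelskii X \<longleftrightarrow> weight X \<le>o |topspace X|"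

text \<open>
  HOL cannot quantify over the type of the image group inside a definition. As an image of \<open>G\<close> has
  at most as many elements as \<open>G\<close>, it has a topologically isomorphic copy carried by a subset of
  the type of \<open>G\<close>, so nothing is lost by considering only such images; the lemma
  \<open>projectively_arhangelskiiD\<close> below makes this precise.
\<close>

definition projectively_arhangelskii :: "('a, 'm) monoid_scheme \<Rightarrow> 'a topology \<Rightarrow> bool" where
  "projectively_arhangelskii G T \<longleftrightarrow>
     (\<forall>(H :: 'a monoid) S h.
        topological_group H S \<and> h \<in> epi G H \<and> continuous_map T S h \<longrightarrow> arhangelskii S)"

lemma weight_attained: "\<exists>\<B>. is_base X \<B> \<and> weight X = |\<B>| \<and> (\<forall>\<C>. is_base X \<C> \<longrightarrow> |\<B>| \<le>o |\<C>| )"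
proof -
  let ?P = "\<lambda>\<B>. is_base X \<B> \<and> (\<forall>\<C>. is_base X \<C> \<longrightarrow> |\<B>| \<le>o |\<C>| )"
  let ?R = "card_of ` {\<B>. is_base X \<B>}"
  have "is_base X {U. openin X U}"
    unfolding is_base_def by blast
  then have "?R \<noteq> {}" by blast
  moreover have "\<forall>r\<in>?R. Well_order r"
    by (intro ballI, elim imageE) (simp only: card_of_Well_order)
  ultimately have "\<exists>r\<in>?R. \<forall>r'\<in>?R. r \<le>o r'"
    by (rule exists_minim_Well_order)
  then have "\<exists>\<B>. ?P \<B>" by (simp only: bex_simps ball_simps mem_Collect_eq)
  then have P: "?P (SOME \<B>. ?P \<B>)" by (rule someI_ex)
  show ?thesis
    by (rule exI[of _ "SOME \<B>. ?P \<B>"], intro conjI)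
      (rule conjunct1[OF P], rule weight_def, rule conjunct2[OF P])
qed

lemma weight_le:
  assumes "is_base X \<C>"
  shows "weight X \<le>o |\<C>|"
proof -
  obtain \<B> where B: "weight X = |\<B>|" "\<forall>\<C>. is_base X \<C> \<longrightarrow> |\<B>| \<le>o |\<C>|"
    using weight_attained[of X] by (elim exE conjE)
  show ?thesis unfolding B(1) using B(2) assms by (elim allE impE)
qed

lemma weight_le_homeomorphic:
  assumes "homeomorphic_maps X Y f g"
  shows "weight X \<le>o weight Y"
proof -
  obtain \<B> where B: "is_base Y \<B>" "weight Y = |\<B>|"
    using weight_attained[of Y] by (elim exE conjE)
  have f: "continuous_map X Y f" and g: "continuous_map Y X g"
    and gf: "\<And>x. x \<in> topspace X \<Longrightarrow> g (f x) = x"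
    and fg: "\<And>y. y \<in> topspace Y \<Longrightarrow> f (g y) = y"
    using assms by (auto simp: homeomorphic_maps_def)
  have hg: "homeomorphic_map Y X g"
    using assms homeomorphic_maps_map by blast
  have "is_base X ((`) g ` \<B>)"
    unfolding is_base_def
  proof (intro conjI allI impI ballI)
    fix V assume "V \<in> (`) g ` \<B>"
    then obtain W where "W \<in> \<B>" "V = g ` W" by blast
    then show "openin X V"
      using B(1) hg homeomorphic_map_openness_eq unfolding is_base_def by blast
  next
    fix U x assume U: "openin X U \<and> x \<in> U"
    then have x: "x \<in> topspace X" using openin_subset by blast
    let ?U = "{y \<in> topspace Y. g y \<in> U}"
    have "openin Y ?U"
      using g U openin_continuous_map_preimage by blast
    moreover have "f x \<in> ?U"
      using x U f gf by (auto simp: continuous_map_def)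
    ultimately obtain W where W: "W \<in> \<B>" "f x \<in> W" "W \<subseteq> ?U"
      using B(1) unfolding is_base_def by meson
    show "\<exists>V\<in>(`) g ` \<B>. x \<in> V \<and> V \<subseteq> U"
      by (rule bexI[of _ "g ` W"]) (use W gf[OF x] in \<open>auto simp: image_iff intro!: bexI[of _ "f x"]\<close>)
  qed
  then have "weight X \<le>o |(`) g ` \<B>|" by (rule weight_le)
  also have "|(`) g ` \<B>| \<le>o |\<B>|" by (rule card_of_image)
  finally (ordLeq_transitive) show ?thesis unfolding B(2) .
qed

lemma projectively_arhangelskiiD:
  fixes G :: "('a, 'm) monoid_scheme" and H :: "('b, 'n) monoid_scheme"
  assumes PA: "projectively_arhangelskii G T"
    and "topological_group H S" and epi: "h \<in> epi G H" and cont: "continuous_map T S h"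
  shows "arhangelskii S"
proof -
  interpret H: topological_group H S by fact
  define g where "g = inv_into (carrier G) h"
  have im: "h ` carrier G = carrier H" using epi by (simp add: epi_def)
  have hg: "h (g y) = y" if "y \<in> carrier H" for y
    using that im unfolding g_def by (metis f_inv_into_f)
  have gG: "g y \<in> carrier G" if "y \<in> carrier H" for y
    using that im unfolding g_def by (metis inv_into_into)
  define A where "A = g ` carrier H"
  have gh: "g (h x) = x" and hA: "h x \<in> carrier H" if "x \<in> A" for x
    using that hg by (auto simp: A_def)
  have gA: "g y \<in> A" if "y \<in> carrier H" for y using that by (simp add: A_def)
  define K :: "'a monoid" where
    "K = \<lparr>carrier = A, mult = (\<lambda>x y. g (h x \<otimes>\<^bsub>H\<^esub> h y)), one = g \<one>\<^bsub>H\<^esub>\<rparr>"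
  define S' where "S' = pullback_topology A h S"
  have tS': "topspace S' = A"
    using hA by (auto simp: S'_def topspace_pullback_topology H.topspace_eq)
  have ch: "continuous_map S' S h"
    unfolding S'_def using continuous_map_pullback[of S S id A h] by simp
  have cg: "continuous_map S S' g"
    unfolding S'_def
  proof (rule continuous_map_pullback')
    show "continuous_map S S (h \<circ> g)"
      by (rule continuous_map_eq[where f = id]) (auto simp: H.topspace_eq hg)
    show "topspace S \<subseteq> g -` A"
      using gA by (auto simp: H.topspace_eq)
  qed
  have homeo: "homeomorphic_maps S S' g h"
    unfolding homeomorphic_maps_def using ch cg hg gh tS' H.topspace_eq by auto
  have K: "group K"
  proof (rule groupI)
    fix x assume "x \<in> carrier K"
    then have "x \<in> A" by (simp add: K_def)
    then show "\<exists>y\<in>carrier K. y \<otimes>\<^bsub>K\<^esub> x = \<one>\<^bsub>K\<^esub>"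
      by (intro bexI[of _ "g (inv\<^bsub>H\<^esub> h x)"]) (auto simp: K_def hg hA gA)
  qed (auto simp: K_def hg hA gA gh H.m_assoc)
  have invK: "inv\<^bsub>K\<^esub> x = g (inv\<^bsub>H\<^esub> h x)" if "x \<in> A" for x
    by (rule group.inv_equality[OF K]) (use that in \<open>auto simp: K_def hg hA gA\<close>)
  have "topological_group K S'"
    unfolding topological_group_def topological_group_axioms_def
  proof (intro conjI K)
    show "topspace S' = carrier K" by (simp add: tS' K_def)
    show "Hausdorff_space S'"
      using homeo H.Hausdorff homeomorphic_Hausdorff_space homeomorphic_space_def by blast
    have "continuous_map S' S' (g \<circ> (\<lambda>x. inv\<^bsub>H\<^esub> x) \<circ> h)"
      using ch cg H.continuous_inv by (meson continuous_map_compose)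
    then show "continuous_map S' S' (\<lambda>x. inv\<^bsub>K\<^esub> x)"
      by (rule continuous_map_eq) (simp add: tS' invK)
    have "continuous_map (prod_topology S' S') (prod_topology S S) (\<lambda>p. (h (fst p), h (snd p)))"
      by (intro continuous_map_pairedI continuous_map_compose[OF continuous_map_fst ch, unfolded o_def]
          continuous_map_compose[OF continuous_map_snd ch, unfolded o_def])
    then have "continuous_map (prod_topology S' S') S'
        (g \<circ> ((\<lambda>(x, y). x \<otimes>\<^bsub>H\<^esub> y) \<circ> (\<lambda>p. (h (fst p), h (snd p)))))"
      using cg H.continuous_mult by (meson continuous_map_compose)
    then show "continuous_map (prod_topology S' S') S' (\<lambda>(x, y). x \<otimes>\<^bsub>K\<^esub> y)"
      by (rule continuous_map_eq) (auto simp: K_def)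
  qed
  moreover have "g \<circ> h \<in> epi G K"
  proof -
    have "g \<circ> h \<in> hom G K"
    proof (rule homI)
      fix x y assume xy: "x \<in> carrier G" "y \<in> carrier G"
      then have "h x \<in> carrier H" "h y \<in> carrier H" using im by auto
      with xy show "(g \<circ> h) (x \<otimes>\<^bsub>G\<^esub> y) = (g \<circ> h) x \<otimes>\<^bsub>K\<^esub> (g \<circ> h) y"
        using epi by (simp add: K_def epi_def hom_def hg)
    qed (use im in \<open>auto simp: K_def A_def\<close>)
    moreover have "(g \<circ> h) ` carrier G = carrier K"
      by (simp only: image_comp[symmetric] im) (simp add: K_def A_def)
    ultimately show ?thesis by (simp add: epi_def)
  qed
  moreover have "continuous_map T S' (g \<circ> h)"
    using cont cg by (rule continuous_map_compose)
  ultimately have "arhangelskii S'"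
    using PA unfolding projectively_arhangelskii_def by blast
  then have "weight S' \<le>o |A|" by (simp add: arhangelskii_def tS')
  moreover have "|A| \<le>o |topspace S|"
    unfolding A_def H.topspace_eq by (rule card_of_image)
  moreover have "weight S \<le>o weight S'"
    by (rule weight_le_homeomorphic[OF homeo])
  ultimately show ?thesis
    unfolding arhangelskii_def by (meson ordLeq_transitive)
qed

end

(* For weight at most the continuum, a continuous image H of a dense subgroup has weight at most the
   continuum (interiors of closures of images of basic neighbourhoods of 1 generate its topology by
   translation), while H is finite or, by a Cantor scheme through G_delta-sets, of size at least
   the continuum.

   Conversely, let w(G) exceed the continuum c. Choose a strictly decreasing chain, of length the
   successor of c, of closed normal subgroups M_i with w(G/M_i) <= c, together with real-indexed
   families of cosets of the M_i, coherent along the chain, such that every nonempty open subset of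
   G/M_i contains c many members of the i-th family. At successor steps each member is refined into
   one of the c many basic open sets of the next quotient; limit steps are free by compactness. For
   the intersection N of the chain this gives a dense set of size c in G/N, whereas w(G/N) > c.
   Closing this set under the group operations and under cluster points of sequences keeps
   its size, and its preimage in G is a dense countably compact subgroup whose image in G/N is not
   Arhangel'skii. *)

theory Submission
  imports Defs "HOL-Algebra.Coset"
begin

no_notation subset_mset (infix \<open><#\<close> 50)
no_notation eq_closure_of (\<open>closure'_of\<index>\<close>)

section \<open>Topological groups and total boundedness\<close>

text \<open>The continuum c is the right bound for two reasons: an infinite continuous image of a
  pseudocompact dense subgroup has at least c points, and c to the power aleph_0 is c, so c many
  points stay c many when closed under operations of countable arity. A quotient is unavoidable in
  the converse, since a regular space with a dense set of size c has weight at most 2^c, whereas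
  w(G) may be larger; G/N is chosen just beyond weight c. The dense set has to be built along with
  the chain, and a representative may be moved only inside its coset. One coset cannot serve c many
  basic open sets at once, which is why each open set is given c many members rather than one. Until
  the very end no quotient is formed: cosets are handled inside G, and weights of quotients are
  replaced by the number of open sets needed to cut out a subgroup. In the end the weight that
  matters is that of D/N, not of G/N; density of D transfers the bound.\<close>

lemma closure_of_meets:
  assumes "x \<in> X closure_of D" "openin X U" "x \<in> U"
  obtains y where "y \<in> D" "y \<in> U"
  using assms unfolding in_closure_of by blast

context topological_group
begin

lemma openin_subset_carrier: "openin T U \<Longrightarrow> U \<subseteq> carrier G"
  using openin_subset topspace_eq by blast

lemma closedin_subset_carrier: "closedin T U \<Longrightarrow> U \<subseteq> carrier G"
  using closedin_subset topspace_eq by blast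

lemma continuous_map_translate_left:
  assumes "a \<in> carrier G"
  shows "continuous_map T T (\<lambda>x. a \<otimes> x)"
proof -
  have "continuous_map T (prod_topology T T) (\<lambda>x. (a, x))"
    using assms by (intro continuous_map_pairedI) (auto simp: topspace_eq)
  from continuous_map_compose[OF this continuous_mult] show ?thesis
    by (simp add: o_def)
qed

lemma continuous_map_translate_right:
  assumes "a \<in> carrier G"
  shows "continuous_map T T (\<lambda>x. x \<otimes> a)"
proof -
  have "continuous_map T (prod_topology T T) (\<lambda>x. (x, a))"
    using assms by (intro continuous_map_pairedI) (auto simp: topspace_eq)
  from continuous_map_compose[OF this continuous_mult] show ?thesis
    by (simp add: o_def)
qed

lemma l_coset_eq_vimage:
  assumes "U \<subseteq> carrier G" "a \<in> carrier G"
  shows "a <# U = {x \<in> carrier G. inv a \<otimes> x \<in> U}"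
proof -
  have "\<exists>h\<in>U. x = a \<otimes> h" if "x \<in> carrier G" "inv a \<otimes> x \<in> U" for x
    using that assms by (intro bexI[of _ "inv a \<otimes> x"]) (auto simp: m_assoc[symmetric])
  then show ?thesis
    using assms by (auto simp: l_coset_def m_assoc[symmetric] subset_iff)
qed

lemma mem_l_coset_self:
  assumes "\<one> \<in> U" "a \<in> carrier G"
  shows "a \<in> a <# U"
  using assms by (auto simp: l_coset_def intro!: bexI[of _ \<one>])

lemma r_coset_eq_vimage:
  assumes "U \<subseteq> carrier G" "a \<in> carrier G"
  shows "U #> a = {x \<in> carrier G. x \<otimes> inv a \<in> U}"
proof -
  have "\<exists>h\<in>U. x = h \<otimes> a" if "x \<in> carrier G" "x \<otimes> inv a \<in> U" for x
    using that assms by (intro bexI[of _ "x \<otimes> inv a"]) (auto simp: m_assoc)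
  then show ?thesis
    using assms by (auto simp: r_coset_def m_assoc subset_iff)
qed

lemma openin_l_coset:
  assumes "openin T U" "a \<in> carrier G"
  shows "openin T (a <# U)"
  unfolding l_coset_eq_vimage[OF openin_subset_carrier[OF assms(1)] assms(2)]
  using openin_continuous_map_preimage[OF continuous_map_translate_left assms(1), of "inv a"] assms(2)
  by (simp add: topspace_eq)

lemma openin_r_coset:
  assumes "openin T U" "a \<in> carrier G"
  shows "openin T (U #> a)"
  unfolding r_coset_eq_vimage[OF openin_subset_carrier[OF assms(1)] assms(2)]
  using openin_continuous_map_preimage[OF continuous_map_translate_right assms(1), of "inv a"] assms(2)
  by (simp add: topspace_eq)

lemma closedin_l_coset:
  assumes "closedin T U" "a \<in> carrier G"
  shows "closedin T (a <# U)"
  unfolding l_coset_eq_vimage[OF closedin_subset_carrier[OF assms(1)] assms(2)]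
  using closedin_continuous_map_preimage[OF continuous_map_translate_left assms(1), of "inv a"] assms(2)
  by (simp add: topspace_eq)

lemma openin_set_mult_right:
  assumes "openin T U" "A \<subseteq> carrier G"
  shows "openin T (U <#> A)"
proof -
  have "U <#> A = (\<Union>a\<in>A. U #> a)"
    by (auto simp: set_mult_def r_coset_def)
  then show ?thesis
    using assms openin_r_coset by (auto intro!: openin_Union)
qed

lemma nbhd_mult:
  assumes "openin T U" "x \<in> carrier G" "y \<in> carrier G" "x \<otimes> y \<in> U"
  obtains V W where "openin T V" "openin T W" "x \<in> V" "y \<in> W"
    "\<And>v w. v \<in> V \<Longrightarrow> w \<in> W \<Longrightarrow> v \<otimes> w \<in> U"
proof -
  let ?P = "{p \<in> topspace (prod_topology T T). (case p of (x, y) \<Rightarrow> x \<otimes> y) \<in> U}"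
  have "openin (prod_topology T T) ?P"
    using openin_continuous_map_preimage[OF continuous_mult assms(1)] .
  moreover have "(x, y) \<in> ?P"
    using assms by (auto simp: topspace_eq)
  ultimately obtain V W where "openin T V" "openin T W" "x \<in> V" "y \<in> W" "V \<times> W \<subseteq> ?P"
    unfolding openin_prod_topology_alt by meson
  then show thesis using that[of V W] by fast
qed

lemma nbhd_symmetric:
  assumes "openin T U" "\<one> \<in> U"
  obtains V where "openin T V" "\<one> \<in> V" "V \<subseteq> U" "\<And>v. v \<in> V \<Longrightarrow> inv v \<in> V"
    "\<And>v w. v \<in> V \<Longrightarrow> w \<in> V \<Longrightarrow> v \<otimes> w \<in> U"
proof -
  obtain V W where VW: "openin T V" "openin T W" "\<one> \<in> V" "\<one> \<in> W"
    "\<And>v w. v \<in> V \<Longrightarrow> w \<in> W \<Longrightarrow> v \<otimes> w \<in> U"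
    using nbhd_mult[of U \<one> \<one>] assms by auto
  let ?A = "V \<inter> W"
  let ?B = "{x \<in> topspace T. inv x \<in> ?A}"
  have A: "openin T ?A" using VW by blast
  have B: "openin T ?B"
    using openin_continuous_map_preimage[OF continuous_inv A] .
  show thesis
  proof (rule that[of "?A \<inter> ?B"])
    show "openin T (?A \<inter> ?B)" using A B by blast
    show one: "\<one> \<in> ?A \<inter> ?B" using VW by (auto simp: topspace_eq)
    show "inv v \<in> ?A \<inter> ?B" if "v \<in> ?A \<inter> ?B" for v
      using that by (auto simp: topspace_eq)
    show m: "v \<otimes> w \<in> U" if "v \<in> ?A \<inter> ?B" "w \<in> ?A \<inter> ?B" for v w
      using that VW by auto
    show "?A \<inter> ?B \<subseteq> U"
    proof
      fix v assume v: "v \<in> ?A \<inter> ?B"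
      then have "v \<otimes> \<one> \<in> U" using m one by blast
      then show "v \<in> U" using v by (simp add: topspace_eq)
    qed
  qed
qed

text \<open>Regularity: if y lies in the closure of x V with V symmetric, then y V meets x V, so y
  lies in x V V.\<close>

lemma nbhd_closure:
  assumes "openin T U" "x \<in> U"
  obtains V where "openin T V" "x \<in> V" "T closure_of V \<subseteq> U"
proof -
  have x: "x \<in> carrier G" using assms openin_subset_carrier by blast
  have oU: "openin T (inv x <# U)" using assms x by (simp add: openin_l_coset)
  have U: "U \<subseteq> carrier G" using assms openin_subset_carrier by blast
  have "\<one> \<in> inv x <# U"
    using assms x by (auto simp: l_coset_eq_vimage[OF U])
  then obtain V where V: "openin T V" "\<one> \<in> V" "\<And>v. v \<in> V \<Longrightarrow> inv v \<in> V"
    "\<And>v w. v \<in> V \<Longrightarrow> w \<in> V \<Longrightarrow> v \<otimes> w \<in> inv x <# U"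
    using nbhd_symmetric[OF oU] by metis
  have VG: "V \<subseteq> carrier G" using V openin_subset_carrier by blast
  show thesis
  proof (rule that[of "x <# V"])
    show "openin T (x <# V)" using V x by (simp add: openin_l_coset)
    show "x \<in> x <# V" using V x by (auto simp: l_coset_eq_vimage[OF VG])
    show "T closure_of (x <# V) \<subseteq> U"
    proof
      fix y assume y: "y \<in> T closure_of (x <# V)"
      then have yG: "y \<in> carrier G" using subsetD[OF closure_of_subset_topspace y] topspace_eq by simp
      have "openin T (y <# V)" "y \<in> y <# V"
        using V yG by (simp_all add: mem_l_coset_self openin_l_coset)
      then obtain z where "z \<in> x <# V" "z \<in> y <# V"
        using y unfolding in_closure_of by blast
      then obtain v w where vw: "v \<in> V" "w \<in> V" "x \<otimes> v = y \<otimes> w"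
        by (auto simp: l_coset_def)
      then have vwG: "v \<in> carrier G" "w \<in> carrier G" using VG by auto
      have "v \<otimes> inv w \<in> inv x <# U" using V vw by blast
      then have "x \<otimes> (v \<otimes> inv w) \<in> U"
        using x by (auto simp: l_coset_eq_vimage[OF U])
      moreover have "x \<otimes> (v \<otimes> inv w) = y"
        using vw vwG x yG by (metis inv_closed m_assoc m_closed r_inv r_one)
      ultimately show "y \<in> U" by simp
    qed
  qed
qed

lemma topological_group_subgroup:
  assumes "subgroup D G"
  shows "topological_group (G\<lparr>carrier := D\<rparr>) (subtopology T D)"
proof -
  have D: "D \<subseteq> carrier G" using assms subgroup.subset by blast
  interpret D: group "G\<lparr>carrier := D\<rparr>" using assms subgroup_imp_group by blast
  have eq: "prod_topology (subtopology T D) (subtopology T D) = subtopology (prod_topology T T) (D \<times> D)"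
    by (simp add: subtopology_Times)
  show ?thesis
  proof
    show "topspace (subtopology T D) = carrier (G\<lparr>carrier := D\<rparr>)"
      using D by (auto simp: topspace_eq)
    show "Hausdorff_space (subtopology T D)" by (simp add: Hausdorff Hausdorff_space_subtopology)
    have "continuous_map (subtopology (prod_topology T T) (D \<times> D)) (subtopology T D) (\<lambda>(x, y). x \<otimes> y)"
      using continuous_mult assms
      by (intro continuous_map_into_subtopology continuous_map_from_subtopology)
         (auto simp: subgroup.m_closed topspace_subtopology)
    then show "continuous_map (prod_topology (subtopology T D) (subtopology T D)) (subtopology T D)
        (\<lambda>(x, y). x \<otimes>\<^bsub>G\<lparr>carrier := D\<rparr>\<^esub> y)"
      by (simp add: eq)
    have "continuous_map (subtopology T D) (subtopology T D) (\<lambda>x. inv x)"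
      using continuous_inv assms
      by (intro continuous_map_into_subtopology continuous_map_from_subtopology)
         (auto simp: subgroup.m_inv_closed topspace_subtopology)
    then show "continuous_map (subtopology T D) (subtopology T D) (\<lambda>x. inv\<^bsub>G\<lparr>carrier := D\<rparr>\<^esub> x)"
      by (rule continuous_map_eq) (use m_inv_consistent[OF assms] in \<open>auto\<close>)
  qed
qed

end

section \<open>Total boundedness and bases of translates\<close>

lemma card_of_UN_finite_ordLeq:
  assumes "infinite K" "|I| \<le>o |K|" "\<And>i. i \<in> I \<Longrightarrow> finite (A i)"
  shows "|\<Union>i\<in>I. A i| \<le>o |K|"
proof (rule card_of_UNION_ordLeq_infinite[OF assms(1,2)], rule ballI)
  fix i assume "i \<in> I"
  then have "|A i| <o |K|"
    using assms by (intro finite_ordLess_infinite[OF card_of_Well_order card_of_Well_order])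
      (simp_all only: Field_card_of assms)
  then show "|A i| \<le>o |K|" by (rule ordLess_imp_ordLeq)
qed

context topological_group
begin

text \<open>Dense subgroups of compact groups and their continuous images need not be compact. Total
  boundedness is the part of compactness that they inherit.\<close>

definition totally_bounded where
  "totally_bounded \<longleftrightarrow> (\<forall>U. openin T U \<and> \<one> \<in> U \<longrightarrow>
     (\<exists>F. finite F \<and> F \<subseteq> carrier G \<and> carrier G \<subseteq> (\<Union>f\<in>F. f <# U)))"

lemma totally_boundedD:
  assumes "totally_bounded" "openin T U" "\<one> \<in> U"
  obtains F where "finite F" "F \<subseteq> carrier G" "carrier G \<subseteq> (\<Union>f\<in>F. f <# U)"
  using assms unfolding totally_bounded_def by meson

lemma totally_bounded_nonempty:
  assumes "totally_bounded" "openin T V" "V \<noteq> {}"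
  obtains F where "finite F" "F \<subseteq> carrier G" "carrier G \<subseteq> (\<Union>f\<in>F. f <# V)"
proof -
  obtain v where v: "v \<in> V" using assms by blast
  have VG: "V \<subseteq> carrier G" using assms openin_subset_carrier by blast
  then have vG: "v \<in> carrier G" using v by blast
  have "openin T (inv v <# V)" using assms vG by (simp add: openin_l_coset)
  moreover have "\<one> \<in> inv v <# V"
    using v vG by (auto simp: l_coset_eq_vimage[OF VG])
  ultimately obtain F where F: "finite F" "F \<subseteq> carrier G" "carrier G \<subseteq> (\<Union>f\<in>F. f <# (inv v <# V))"
    by (rule totally_boundedD[OF assms(1)])
  show thesis
  proof (rule that[of "(\<lambda>f. f \<otimes> inv v) ` F"])
    have "f <# (inv v <# V) = (f \<otimes> inv v) <# V" if "f \<in> F" for f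
      using that F VG vG by (intro lcos_m_assoc) auto
    then show "carrier G \<subseteq> (\<Union>f\<in>(\<lambda>f. f \<otimes> inv v) ` F. f <# V)"
      using F(3) by auto
  qed (use F vG in auto)
qed

text \<open>If g = f v with v in V, then f V Q = g v^{-1} V Q, and this lies in U as soon as V^{-1}
  V Q lies in g^{-1} U. Hence for each V finitely many translates that cover the group suffice,
  wherever g lies. With Q = {1} this yields a base of the group, with a normal Q a base of the
  quotient by Q.\<close>

lemma translates_base:
  assumes tb: "totally_bounded" and K: "infinite K" "|\<V>| \<le>o |K|"
    and V: "\<And>V. V \<in> \<V> \<Longrightarrow> openin T V \<and> V \<noteq> {}"
    and Q: "Q \<subseteq> carrier G"
    and base: "\<And>U. openin T U \<Longrightarrow> Q \<subseteq> U \<Longrightarrow> \<exists>V\<in>\<V>. \<forall>v\<in>V. \<forall>w\<in>V. \<forall>q\<in>Q. inv v \<otimes> w \<otimes> q \<in> U"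
  obtains \<B> where "|\<B>| \<le>o |K|" "\<And>B. B \<in> \<B> \<Longrightarrow> openin T B"
    "\<And>g U. g \<in> carrier G \<Longrightarrow> openin T U \<Longrightarrow> g <# Q \<subseteq> U \<Longrightarrow> \<exists>B\<in>\<B>. g \<in> B \<and> B <#> Q \<subseteq> U"
proof -
  have "\<exists>F. finite F \<and> F \<subseteq> carrier G \<and> carrier G \<subseteq> (\<Union>f\<in>F. f <# V)" if "V \<in> \<V>" for V
    using totally_bounded_nonempty[OF tb] V[OF that] by metis
  then obtain F where F: "\<And>V. V \<in> \<V> \<Longrightarrow> finite (F V)" "\<And>V. V \<in> \<V> \<Longrightarrow> F V \<subseteq> carrier G"
    "\<And>V. V \<in> \<V> \<Longrightarrow> carrier G \<subseteq> (\<Union>f\<in>F V. f <# V)" by metis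
  define \<B> where "\<B> = (\<Union>V\<in>\<V>. (\<lambda>f. f <# V) ` F V)"
  show thesis
  proof (rule that[of \<B>])
    show "|\<B>| \<le>o |K|"
      unfolding \<B>_def using K F by (intro card_of_UN_finite_ordLeq) auto
    show "openin T B" if "B \<in> \<B>" for B
      using that F(2) V unfolding \<B>_def by (fast intro: openin_l_coset)
  next
    fix g U assume g: "g \<in> carrier G" and U: "openin T U" "g <# Q \<subseteq> U"
    have UG: "U \<subseteq> carrier G" using U openin_subset_carrier by blast
    have "openin T (inv g <# U)" using U g by (simp add: openin_l_coset)
    moreover have "Q \<subseteq> inv g <# U"
      using U(2) g Q unfolding l_coset_eq_vimage[OF UG inv_closed[OF g]]
      by (auto simp: l_coset_def)
    ultimately obtain V where V1: "V \<in> \<V>"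
      "\<And>v w q. v \<in> V \<Longrightarrow> w \<in> V \<Longrightarrow> q \<in> Q \<Longrightarrow> inv v \<otimes> w \<otimes> q \<in> inv g <# U"
      using base by meson
    have VG: "V \<subseteq> carrier G" using V V1(1) openin_subset_carrier by blast
    obtain f where f: "f \<in> F V" "g \<in> f <# V" using F(3)[OF V1(1)] g by blast
    then have fG: "f \<in> carrier G" using F V1 by blast
    obtain v where v: "v \<in> V" "g = f \<otimes> v" using f by (auto simp: l_coset_def)
    have vG: "v \<in> carrier G" using v VG by blast
    have "(f <# V) <#> Q \<subseteq> U"
    proof
      fix x assume "x \<in> (f <# V) <#> Q"
      then obtain w q where wq: "w \<in> V" "q \<in> Q" "x = f \<otimes> w \<otimes> q"
        by (auto simp: l_coset_def set_mult_def)
      then have wqG: "w \<in> carrier G" "q \<in> carrier G" using VG Q by auto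
      have "inv v \<otimes> w \<otimes> q \<in> inv g <# U" using V1 v wq by blast
      then have "g \<otimes> (inv v \<otimes> w \<otimes> q) \<in> U"
        using g by (auto simp: l_coset_eq_vimage[OF UG])
      moreover have "g \<otimes> (inv v \<otimes> w \<otimes> q) = x"
        using v wq wqG fG vG by (simp add: m_assoc inv_solve_left' flip: m_assoc[of v "inv v"])
      ultimately show "x \<in> U" by simp
    qed
    then show "\<exists>B\<in>\<B>. g \<in> B \<and> B <#> Q \<subseteq> U"
      using f V1(1) unfolding \<B>_def by blast
  qed
qed

lemma is_base_translates:
  assumes "\<And>B. B \<in> \<B> \<Longrightarrow> openin T B"
    and "\<And>g U. g \<in> carrier G \<Longrightarrow> openin T U \<Longrightarrow> g <# {\<one>} \<subseteq> U \<Longrightarrow> \<exists>B\<in>\<B>. g \<in> B \<and> B <#> {\<one>} \<subseteq> U"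
  shows "is_base T \<B>"
  unfolding is_base_def
  proof (intro conjI allI impI ballI)
    show "openin T V" if "V \<in> \<B>" for V using assms(1) that by blast
  next
    fix U x assume U: "openin T U \<and> x \<in> U"
    then have x: "x \<in> carrier G" using openin_subset_carrier by blast
    then obtain B where B: "B \<in> \<B>" "x \<in> B" "B <#> {\<one>} \<subseteq> U"
      using assms(2)[of x U] U by (auto simp: l_coset_def)
    have "B \<subseteq> carrier G" using B assms(1) openin_subset_carrier by blast
    then have "(\<lambda>b. b \<otimes> \<one>) ` B = B" by (auto simp: subset_iff image_iff)
    then have "B <#> {\<one>} = B" by (simp add: set_mult_def UNION_singleton_eq_range)
    with B show "\<exists>V\<in>\<B>. x \<in> V \<and> V \<subseteq> U" by auto
  qed

lemma weight_le_translates: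
  assumes tb: "totally_bounded" and K: "infinite K" "|\<V>| \<le>o |K|"
    and V: "\<And>V. V \<in> \<V> \<Longrightarrow> openin T V \<and> V \<noteq> {}"
    and base: "\<And>U. openin T U \<Longrightarrow> \<one> \<in> U \<Longrightarrow> \<exists>V\<in>\<V>. \<forall>v\<in>V. \<forall>w\<in>V. inv v \<otimes> w \<in> U"
  shows "weight T \<le>o |K|"
proof -
  have b: "\<exists>V\<in>\<V>. \<forall>v\<in>V. \<forall>w\<in>V. \<forall>q\<in>{\<one>}. inv v \<otimes> w \<otimes> q \<in> U"
    if U: "openin T U" "{\<one>} \<subseteq> U" for U
  proof -
    obtain W where W: "W \<in> \<V>" "\<forall>v\<in>W. \<forall>w\<in>W. inv v \<otimes> w \<in> U" using base[OF U(1)] U(2) by auto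
    moreover have "W \<subseteq> carrier G" using W V openin_subset_carrier by blast
    ultimately show ?thesis by (intro bexI[of _ W]) (auto simp: subset_iff)
  qed
  obtain \<B> where \<B>: "|\<B>| \<le>o |K|" "\<And>B. B \<in> \<B> \<Longrightarrow> openin T B"
    "\<And>g U. g \<in> carrier G \<Longrightarrow> openin T U \<Longrightarrow> g <# {\<one>} \<subseteq> U \<Longrightarrow> \<exists>B\<in>\<B>. g \<in> B \<and> B <#> {\<one>} \<subseteq> U"
    using translates_base[OF tb K V _ b] by (metis empty_subsetI insert_subset one_closed)
  have "is_base T \<B>" using is_base_translates \<B>(2,3) by blast
  then show ?thesis using \<B>(1) weight_le ordLeq_transitive by blast
qed

text \<open>By density the translates d V with d in D and V symmetric already cover all of G, so
  compactness of G leaves finitely many. For x in D a factorisation x = f v forces v into D, hence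
  these translates also work inside D.\<close>

lemma totally_bounded_dense_subgroup:
  assumes "compact_space T" "subgroup D G" "dense_in T D"
  shows "topological_group.totally_bounded (G\<lparr>carrier := D\<rparr>) (subtopology T D)"
proof -
  interpret D: topological_group "G\<lparr>carrier := D\<rparr>" "subtopology T D"
    using assms topological_group_subgroup by blast
  have DG: "D \<subseteq> carrier G" using assms subgroup.subset by blast
  show ?thesis
    unfolding D.totally_bounded_def
  proof (intro allI impI, elim conjE)
    fix U assume "openin (subtopology T D) U" "\<one>\<^bsub>G\<lparr>carrier := D\<rparr>\<^esub> \<in> U"
    then obtain W where W: "openin T W" "\<one> \<in> W" "U = W \<inter> D"
      by (auto simp: openin_subtopology)
    obtain V where V: "openin T V" "\<one> \<in> V" "V \<subseteq> W" "\<And>v. v \<in> V \<Longrightarrow> inv v \<in> V"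
      using nbhd_symmetric[OF W(1,2)] by metis
    have VG: "V \<subseteq> carrier G" using V openin_subset_carrier by blast
    have cov: "\<exists>d\<in>D. x \<in> d <# V" if x: "x \<in> carrier G" for x
    proof -
      have "openin T (x <# V)" "x \<in> x <# V"
        using V x by (simp_all add: mem_l_coset_self openin_l_coset)
      moreover have "x \<in> T closure_of D" using assms(3) x by (simp add: dense_in_def topspace_eq)
      ultimately obtain d where d: "d \<in> D" "d \<in> x <# V" by (metis in_closure_of)
      then have dG: "d \<in> carrier G" using DG by blast
      have "inv x \<otimes> d \<in> V" using d x by (auto simp: l_coset_eq_vimage[OF VG])
      then have "inv (inv x \<otimes> d) \<in> V" using V by blast
      then have "inv d \<otimes> x \<in> V" using dG x by (simp add: inv_mult_group)
      then have "x \<in> d <# V" using x by (simp add: l_coset_eq_vimage[OF VG dG])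
      then show ?thesis using d(1) by blast
    qed
    have "\<forall>U\<in>(\<lambda>d. d <# V) ` D. openin T U" using V DG openin_l_coset by auto
    moreover have "topspace T \<subseteq> \<Union>((\<lambda>d. d <# V) ` D)"
      using cov by (auto simp: topspace_eq)
    ultimately obtain \<F> where \<F>: "finite \<F>" "\<F> \<subseteq> (\<lambda>d. d <# V) ` D" "topspace T \<subseteq> \<Union>\<F>"
      using assms(1) unfolding compact_space_alt by metis
    obtain F where F: "F \<subseteq> D" "finite F" "\<F> = (\<lambda>d. d <# V) ` F"
      using finite_subset_image[OF \<F>(1,2)] by blast
    show "\<exists>F. finite F \<and> F \<subseteq> carrier (G\<lparr>carrier := D\<rparr>) \<and>
        carrier (G\<lparr>carrier := D\<rparr>) \<subseteq> (\<Union>f\<in>F. f <#\<^bsub>G\<lparr>carrier := D\<rparr>\<^esub> U)"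
    proof (intro exI conjI)
      show "carrier (G\<lparr>carrier := D\<rparr>) \<subseteq> (\<Union>f\<in>F. f <#\<^bsub>G\<lparr>carrier := D\<rparr>\<^esub> U)"
      proof
        fix x assume "x \<in> carrier (G\<lparr>carrier := D\<rparr>)"
        then have x: "x \<in> D" by simp
        then obtain f where f: "f \<in> F" "x \<in> f <# V"
          using \<F>(3) DG unfolding F(3) topspace_eq by blast
        then obtain v where v: "v \<in> V" "x = f \<otimes> v" by (auto simp: l_coset_def)
        have fD: "f \<in> D" using f F by blast
        have "v = inv f \<otimes> x"
          using v fD DG VG by (metis inv_solve_left subsetD x)
        then have "v \<in> D" using assms(2) fD x by (simp add: subgroup.m_closed subgroup.m_inv_closed)
        then have "v \<in> U" using v V W by blast
        then show "x \<in> (\<Union>f\<in>F. f <#\<^bsub>G\<lparr>carrier := D\<rparr>\<^esub> U)"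
          using f(1) v(2) by (auto simp: l_coset_def)
      qed
    qed (use F in auto)
  qed
qed

end

section \<open>Images of \<open>G\<^sub>\<delta>\<close>-dense subgroups\<close>

lemma countably_compact_imp_pseudocompact:
  assumes "countably_compact_space X"
  shows "pseudocompact_space X"
  unfolding pseudocompact_space_def
proof (intro allI impI)
  fix f assume f: "continuous_map X euclideanreal f"
  define U where "U n = {x \<in> topspace X. f x \<in> {- real n<..<real n}}" for n :: nat
  have "openin X (U n)" for n
    unfolding U_def by (rule openin_continuous_map_preimage[OF f]) auto
  moreover have "topspace X \<subseteq> \<Union>(range U)"
  proof
    fix x assume x: "x \<in> topspace X"
    obtain n where "\<bar>f x\<bar> < real n" using reals_Archimedean2 by blast
    then have "x \<in> U n" using x by (auto simp: U_def)
    then show "x \<in> \<Union>(range U)" by blast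
  qed
  ultimately obtain \<F> where \<F>: "finite \<F>" "\<F> \<subseteq> range U" "topspace X \<subseteq> \<Union>\<F>"
    using assms unfolding countably_compact_space_def
    by (metis (mono_tags, lifting) countable_image countableI_type rangeE)
  obtain F where F: "finite F" "\<F> = U ` F"
    using finite_subset_image[OF \<F>(1,2)] by blast
  have "norm y \<le> real (Max (insert 0 F))" if y: "y \<in> f ` topspace X" for y
  proof -
    obtain x n where "y = f x" "n \<in> F" "x \<in> U n" using y \<F>(3) F(2) by blast
    moreover from this have "real n \<le> real (Max (insert 0 F))" using F by simp
    ultimately show ?thesis by (auto simp: U_def)
  qed
  then show "bounded (f ` topspace X)" unfolding bounded_iff by blast
qed

lemma gdelta_in_sequence:
  assumes "gdelta_in X B"
  obtains U :: "nat \<Rightarrow> 'a set" where "\<And>n. openin X (U n)" "B = (\<Inter>n. U n)"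
proof -
  obtain \<U> where \<U>: "countable \<U>" "\<U> \<subseteq> Collect (openin X)" "B = \<Inter>\<U>"
    using assms unfolding gdelta_in_alt intersection_of_def by auto
  have B: "B \<subseteq> topspace X" using assms gdelta_in_subset by blast
  \<comment> \<open>Adding the whole space makes the family nonempty, so that it can be enumerated
    by the naturals, and leaves the intersection unchanged.\<close>
  let ?V = "insert (topspace X) \<U>"
  have r: "range (from_nat_into ?V) = ?V"
    using \<U> by (intro range_from_nat_into) auto
  show thesis
  proof (rule that[of "from_nat_into ?V"])
    show "openin X (from_nat_into ?V n)" for n
      using from_nat_into[of ?V n] \<U> by auto
    show "B = (\<Inter>n. from_nat_into ?V n)"
      using r \<U> B by auto
  qed
qed

text \<open>A point of a \<open>G\<^sub>\<delta>\<close>-set that misses \<open>D\<close> gives a continuous \<open>F \<ge> 0\<close> that vanishes there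
  but not on \<open>D\<close>; then \<open>1 / F\<close> is unbounded on \<open>D\<close>.\<close>

lemma pseudocompact_dense_imp_gdelta_dense:
  assumes X: "compact_space X" "Hausdorff_space X" and D: "dense_in X D"
    and pc: "pseudocompact_space (subtopology X D)"
  shows "gdelta_dense_in X D"
  unfolding gdelta_dense_in_def
proof (intro conjI allI impI)
  show DX: "D \<subseteq> topspace X" using D by (simp add: dense_in_def)
  fix B assume "gdelta_in X B \<and> B \<noteq> {}"
  then obtain x where B: "gdelta_in X B" and x: "x \<in> B" by blast
  have xX: "x \<in> topspace X" using x gdelta_in_subset[OF B] by blast
  show "D \<inter> B \<noteq> {}"
  proof
    assume disj: "D \<inter> B = {}"
    obtain U where U: "\<And>n::nat. openin X (U n)" "B = (\<Inter>n. U n)"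
      using gdelta_in_sequence[OF B] by blast
    have norm: "normal_space X"
      using X compact_Hausdorff_or_regular_imp_normal_space by blast
    have "\<exists>f. continuous_map X euclideanreal f \<and> f x = 0 \<and> (\<forall>y\<in>topspace X - U n. f y = 1)" for n
    proof -
      have "closedin X {x}" using X xX by (simp add: closedin_Hausdorff_sing_eq)
      moreover have "closedin X (topspace X - U n)" using U by blast
      moreover have "disjnt {x} (topspace X - U n)" using x U by (auto simp: disjnt_def)
      ultimately obtain f where "continuous_map X (top_of_set {0..1::real}) f"
        "f ` {x} \<subseteq> {0}" "f ` (topspace X - U n) \<subseteq> {1}"
        using Urysohn_lemma[OF norm, of "{x}" "topspace X - U n" 0 1] by auto
      then show ?thesis
        by (intro exI[of _ f]) (auto simp: continuous_map_in_subtopology)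
    qed
    then obtain f where f: "\<And>n. continuous_map X euclideanreal (f n)" "\<And>n. f n x = 0"
      "\<And>n y. y \<in> topspace X \<Longrightarrow> y \<notin> U n \<Longrightarrow> f n y = 1" by (metis DiffI)
    \<comment> \<open>The sequence space has a metric for the product topology, so one distance
      combines the countably many f_n into a continuous function that vanishes exactly where all of
      them do.\<close>
    define F where "F y = dist (\<lambda>n. f n y) (\<lambda>n. 0)" for y
    have "continuous_map X (product_topology (\<lambda>i. euclideanreal) UNIV) (\<lambda>y n. f n y)"
      using f by (simp add: continuous_map_componentwise_UNIV)
    then have c: "continuous_map X euclidean (\<lambda>y n. f n y)"
      by (simp add: euclidean_product_topology)
    have "continuous_map euclidean euclideanreal (\<lambda>z::nat \<Rightarrow> real. dist z (\<lambda>n. 0))"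
      by (simp add: continuous_on_dist)
    from continuous_map_compose[OF c this] have F: "continuous_map X euclideanreal F"
      by (simp add: F_def[abs_def] o_def)
    have F0: "F y \<noteq> 0" if "y \<in> D" for y
    proof -
      have "y \<notin> B" using that disj by blast
      then obtain n where "y \<notin> U n" using U by blast
      then have "f n y \<noteq> 0" using f that DX by auto
      then have "(\<lambda>n. f n y) \<noteq> (\<lambda>n. 0)" by metis
      then show ?thesis by (simp add: F_def)
    qed
    have "continuous_map (subtopology X D) euclideanreal (\<lambda>y. inverse (F y))"
      using F0 F by (intro continuous_map_real_inverse continuous_map_from_subtopology) auto
    then have "bounded ((\<lambda>y. inverse (F y)) ` D)"
      using pc DX unfolding pseudocompact_space_def by (metis topspace_subtopology_subset)
    then obtain M where M: "M > 0" "\<And>y. y \<in> D \<Longrightarrow> \<bar>inverse (F y)\<bar> \<le> M"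
      unfolding bounded_pos by auto
    let ?W = "{y \<in> topspace X. F y \<in> {..<inverse M}}"
    have "x \<in> X closure_of D" using D xX by (simp add: dense_in_def)
    moreover have "openin X ?W" by (rule openin_continuous_map_preimage[OF F]) auto
    moreover have "x \<in> ?W" using xX f M by (auto simp: F_def)
    ultimately obtain y where y: "y \<in> D" "y \<in> ?W" by (rule closure_of_meets)
    then have "F y > 0" using F0[of y] by (simp add: F_def less_le)
    then have "M < inverse (F y)" using y M(1) by (simp add: field_simps)
    then show False using M(2)[OF y(1)] by linarith
  qed
qed

lemma gdelta_dense_imp_dense:
  assumes "gdelta_dense_in X D"
  shows "dense_in X D"
  unfolding dense_in_def
proof
  show "D \<subseteq> topspace X" using assms by (simp add: gdelta_dense_in_def)
  have "x \<in> X closure_of D" if "x \<in> topspace X" for x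
    unfolding in_closure_of
  proof (intro conjI allI impI that)
    fix U assume "x \<in> U \<and> openin X U"
    then have "D \<inter> U \<noteq> {}"
      using assms open_imp_gdelta_in[of X U] unfolding gdelta_dense_in_def by blast
    then show "\<exists>y. y \<in> D \<and> y \<in> U" by blast
  qed
  then show "X closure_of D = topspace X" using closure_of_subset_topspace[of X D] by blast
qed

section \<open>Weight and cardinality of continuous images of dense subgroups\<close>

lemma weight_finite_Hausdorff:
  assumes "finite (topspace X)" "Hausdorff_space X"
  shows "weight X \<le>o |topspace X|"
proof -
  have sing: "openin X {x}" if "x \<in> topspace X" for x
  proof -
    have "closedin X (topspace X - {x})"
      using assms closedin_Hausdorff_finite[of X "topspace X - {x}"] by blast
    then have "openin X (topspace X - (topspace X - {x}))" by blast
    then show ?thesis using that by (simp add: double_diff)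
  qed
  have "is_base X ((\<lambda>x. {x}) ` topspace X)"
    unfolding is_base_def using sing openin_subset by fastforce
  then have "weight X \<le>o |(\<lambda>x. {x}) ` topspace X|" by (rule weight_le)
  then show ?thesis using card_of_image ordLeq_transitive by blast
qed

context topological_group
begin

lemma epi_topological_group:
  assumes H: "topological_group H S" and h: "h \<in> epi G H"
  shows "h \<one> = \<one>\<^bsub>H\<^esub>" "\<And>x. x \<in> carrier G \<Longrightarrow> h x \<in> carrier H"
    "\<And>x y. x \<in> carrier G \<Longrightarrow> y \<in> carrier G \<Longrightarrow> h (x \<otimes> y) = h x \<otimes>\<^bsub>H\<^esub> h y"
    "h ` carrier G = carrier H"
proof -
  interpret H: topological_group H S by (fact H)
  interpret gh: group_hom G H h
    using h by unfold_locales (auto simp: epi_def)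
  show "h \<one> = \<one>\<^bsub>H\<^esub>" "\<And>x. x \<in> carrier G \<Longrightarrow> h x \<in> carrier H"
    "\<And>x y. x \<in> carrier G \<Longrightarrow> y \<in> carrier G \<Longrightarrow> h (x \<otimes> y) = h x \<otimes>\<^bsub>H\<^esub> h y" by auto
  show "h ` carrier G = carrier H" using h by (simp add: epi_def)
qed

lemma totally_bounded_image:
  assumes tb: totally_bounded and H: "topological_group H S"
    and h: "h \<in> epi G H" "continuous_map T S h"
  shows "topological_group.totally_bounded H S"
proof -
  interpret H: topological_group H S by (fact H)
  note hom = epi_topological_group[OF H h(1)]
  show ?thesis
    unfolding H.totally_bounded_def
  proof (intro allI impI, elim conjE)
    fix U assume U: "openin S U" "\<one>\<^bsub>H\<^esub> \<in> U"
    let ?W = "{x \<in> topspace T. h x \<in> U}"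
    have "openin T ?W" using openin_continuous_map_preimage[OF h(2) U(1)] .
    moreover have "\<one> \<in> ?W" using U hom by (simp add: topspace_eq)
    ultimately obtain F where F: "finite F" "F \<subseteq> carrier G" "carrier G \<subseteq> (\<Union>f\<in>F. f <# ?W)"
      using tb unfolding totally_bounded_def by meson
    show "\<exists>F. finite F \<and> F \<subseteq> carrier H \<and> carrier H \<subseteq> (\<Union>f\<in>F. f <#\<^bsub>H\<^esub> U)"
    proof (intro exI conjI subsetI)
      fix y assume "y \<in> carrier H"
      then obtain x where x: "x \<in> carrier G" "y = h x" using hom by blast
      then obtain f w where "f \<in> F" "w \<in> ?W" "x = f \<otimes> w"
        using F(3) by (fastforce simp: l_coset_def)
      then show "y \<in> (\<Union>f\<in>h ` F. f <#\<^bsub>H\<^esub> U)"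
        using x F(2) hom(3)[of f w] by (auto simp: l_coset_def topspace_eq)
    qed (use F hom in auto)
  qed
qed

end

context topological_group
begin

text \<open>The map h need not be open, so the image of a basic neighbourhood of 1 need not be a
  neighbourhood. Its closure nevertheless has nonempty interior: finitely many translates of it
  cover H, and a finite union of closed sets without interior has no interior. Nonemptiness of these
  interiors is all that \<open>weight_le_translates\<close> asks for.\<close>

lemma weight_image_le:
  assumes T: "compact_space T" and D: "subgroup D G" "dense_in T D"
    and H: "topological_group H S"
    and h: "h \<in> epi (G\<lparr>carrier := D\<rparr>) H" "continuous_map (subtopology T D) S h"
    and K: "infinite K" "weight T \<le>o |K|"
  shows "weight S \<le>o |K|"
proof -
  interpret D: topological_group "G\<lparr>carrier := D\<rparr>" "subtopology T D"
    using D topological_group_subgroup by blast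
  interpret H: topological_group H S by (fact H)
  have DG: "D \<subseteq> carrier G" using D subgroup.subset by blast
  note hom = D.epi_topological_group[OF H h(1), simplified]
  have tbD: "D.totally_bounded" using totally_bounded_dense_subgroup T D by blast
  have tbH: "H.totally_bounded" using D.totally_bounded_image[OF tbD H h] .
  obtain \<B> where \<B>: "is_base T \<B>" "weight T = |\<B>|" using weight_attained[of T] by blast
  define V where "V B = S interior_of (S closure_of (h ` (B \<inter> D)))" for B
  let ?\<V> = "V ` {B \<in> \<B>. \<one> \<in> B}"
  show ?thesis
  proof (rule H.weight_le_translates[OF tbH K(1)])
    have "|?\<V>| \<le>o |{B \<in> \<B>. \<one> \<in> B}|" by (rule card_of_image)
    also have "|{B \<in> \<B>. \<one> \<in> B}| \<le>o |\<B>|" by (rule card_of_mono1) auto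
    also have "|\<B>| \<le>o |K|" using K \<B> by simp
    finally show "|?\<V>| \<le>o |K|" .
  next
    fix W assume "W \<in> ?\<V>"
    then obtain B where B: "B \<in> \<B>" "\<one> \<in> B" "W = V B" by blast
    define C where "C = S closure_of (h ` (B \<inter> D))"
    have oB: "openin T B" using \<B> B unfolding is_base_def by blast
    then have "openin (subtopology T D) (B \<inter> D)" "\<one>\<^bsub>G\<lparr>carrier := D\<rparr>\<^esub> \<in> B \<inter> D"
      using B D by (auto simp: openin_subtopology subgroup.one_closed)
    then obtain F where F: "finite F" "F \<subseteq> D" "D \<subseteq> (\<Union>f\<in>F. f <#\<^bsub>G\<lparr>carrier := D\<rparr>\<^esub> (B \<inter> D))"
      using D.totally_boundedD[OF tbD, of "B \<inter> D"] by auto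
    have hBS: "h ` (B \<inter> D) \<subseteq> carrier H" using hom by auto
    have CS: "h ` (B \<inter> D) \<subseteq> C" unfolding C_def
      using closure_of_subset hBS H.topspace_eq by metis
    have cC: "closedin S C" unfolding C_def by simp
    have ne: "S interior_of (f <#\<^bsub>H\<^esub> C) = {}" if "S interior_of C = {}" "f \<in> carrier H" for f
    proof (rule ccontr)
      let ?I = "S interior_of (f <#\<^bsub>H\<^esub> C)"
      assume "?I \<noteq> {}"
      then obtain x where x: "x \<in> ?I" by blast
      have oI: "openin S ?I" by simp
      have IH: "?I \<subseteq> carrier H" using H.openin_subset_carrier[OF oI] .
      have "inv\<^bsub>H\<^esub> f <#\<^bsub>H\<^esub> ?I \<subseteq> C"
      proof
        fix y assume "y \<in> inv\<^bsub>H\<^esub> f <#\<^bsub>H\<^esub> ?I"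
        then obtain z where z: "z \<in> ?I" "y = inv\<^bsub>H\<^esub> f \<otimes>\<^bsub>H\<^esub> z" by (auto simp: l_coset_def)
        then have "z \<in> f <#\<^bsub>H\<^esub> C" using interior_of_subset by fast
        then show "y \<in> C" using z(2) that(2) H.closedin_subset_carrier[OF cC]
          by (simp add: H.l_coset_eq_vimage)
      qed
      moreover have "openin S (inv\<^bsub>H\<^esub> f <#\<^bsub>H\<^esub> ?I)" using oI that H.openin_l_coset by simp
      ultimately have "inv\<^bsub>H\<^esub> f <#\<^bsub>H\<^esub> ?I \<subseteq> S interior_of C" by (simp add: interior_of_maximal)
      then show False using x that by (auto simp: l_coset_def)
    qed
    have "S interior_of C \<noteq> {}"
    proof
      assume C0: "S interior_of C = {}"
      have "S interior_of (\<Union>f\<in>F'. h f <#\<^bsub>H\<^esub> C) = {}" if "finite F'" "F' \<subseteq> F" for F'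
        using that
      proof (induction F')
        case (insert f F')
        have "h f \<in> carrier H" using insert F hom by auto
        then show ?case
          using insert ne[OF C0] interior_of_union_eq_empty[OF H.closedin_l_coset[OF cC]] by simp
      qed simp
      then have "S interior_of (\<Union>f\<in>F. h f <#\<^bsub>H\<^esub> C) = {}" using F by blast
      moreover have "carrier H \<subseteq> (\<Union>f\<in>F. h f <#\<^bsub>H\<^esub> C)"
      proof
        fix y assume "y \<in> carrier H"
        then obtain x where x: "x \<in> D" "y = h x" using hom by blast
        then obtain f b where f: "f \<in> F" "b \<in> B \<inter> D" "x = f \<otimes> b"
          using F(3) by (fastforce simp: l_coset_def)
        then have "h b \<in> C" using CS by blast
        then show "y \<in> (\<Union>f\<in>F. h f <#\<^bsub>H\<^esub> C)"
          using f x F hom(3)[of f b] by (auto simp: l_coset_def)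
      qed
      moreover have "(\<Union>f\<in>F. h f <#\<^bsub>H\<^esub> C) \<subseteq> carrier H"
        using H.closedin_subset_carrier[OF cC] F(2) hom(2) by (force simp: l_coset_def)
      ultimately have "S interior_of (topspace S) = {}" by (metis H.topspace_eq subset_antisym)
      then show False using H.topspace_eq H.one_closed by (metis empty_iff interior_of_topspace)
    qed
    then show "openin S W \<and> W \<noteq> {}" using B by (simp add: V_def C_def)
  next
    fix U assume U: "openin S U" "\<one>\<^bsub>H\<^esub> \<in> U"
    obtain U1 where U1: "openin S U1" "\<one>\<^bsub>H\<^esub> \<in> U1" "\<And>v. v \<in> U1 \<Longrightarrow> inv\<^bsub>H\<^esub> v \<in> U1"
      "\<And>v w. v \<in> U1 \<Longrightarrow> w \<in> U1 \<Longrightarrow> v \<otimes>\<^bsub>H\<^esub> w \<in> U" using H.nbhd_symmetric[OF U] by metis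
    \<comment> \<open>The sets \<open>V B\<close> come from closures, hence the extra shrinking to a
      neighbourhood whose closure stays inside U1.\<close>
    obtain U2 where U2: "openin S U2" "\<one>\<^bsub>H\<^esub> \<in> U2" "S closure_of U2 \<subseteq> U1"
      using H.nbhd_closure[OF U1(1,2)] by metis
    have "openin (subtopology T D) {x \<in> topspace (subtopology T D). h x \<in> U2}"
      using openin_continuous_map_preimage[OF h(2) U2(1)] .
    then obtain N where N: "openin T N" "{x \<in> topspace (subtopology T D). h x \<in> U2} = N \<inter> D"
      by (auto simp: openin_subtopology)
    have "\<one> \<in> D" using D subgroup.one_closed by blast
    then have "\<one> \<in> {x \<in> topspace (subtopology T D). h x \<in> U2}"
      using U2 hom by (simp add: topspace_eq)
    then have "\<one> \<in> N" using N by blast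
    then obtain B where B: "B \<in> \<B>" "\<one> \<in> B" "B \<subseteq> N" using \<B>(1) N(1) unfolding is_base_def by meson
    have "h ` (B \<inter> D) \<subseteq> U2" using N B by blast
    then have "S closure_of (h ` (B \<inter> D)) \<subseteq> U1" using U2(3) closure_of_mono by blast
    then have "V B \<subseteq> U1" unfolding V_def using interior_of_subset by fast
    then show "\<exists>V\<in>?\<V>. \<forall>v\<in>V. \<forall>w\<in>V. inv\<^bsub>H\<^esub> v \<otimes>\<^bsub>H\<^esub> w \<in> U"
      using B U1(3,4) by (intro bexI[of _ "V B"]) (auto simp: subset_iff)
  qed
qed

text \<open>Every branch of a Cantor scheme of translates of neighbourhoods of the identity is a nonempty
  \<open>G\<^sub>\<delta>\<close>-set, hence meets \<open>D\<close>; the neighbourhoods are chosen so small that \<open>h\<close> separates the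
  branches.\<close>

lemma gdelta_dense_image_ge_continuum:
  assumes T: "compact_space T" and D: "subgroup D G" "gdelta_dense_in T D"
    and H: "topological_group H S"
    and h: "h \<in> epi (G\<lparr>carrier := D\<rparr>) H" "continuous_map (subtopology T D) S h"
    and inf: "infinite (carrier H)"
  shows "|UNIV :: real set| \<le>o |carrier H|"
proof -
  interpret D: topological_group "G\<lparr>carrier := D\<rparr>" "subtopology T D"
    using D topological_group_subgroup by blast
  interpret H: topological_group H S by (fact H)
  have DG: "D \<subseteq> carrier G" using D subgroup.subset by blast
  note hom = D.epi_topological_group[OF H h(1), simplified]
  have D1: "\<one> \<in> D" using D subgroup.one_closed by blast
  have mD: "x \<otimes> y \<in> D" if "x \<in> D" "y \<in> D" for x y using that D subgroup.m_closed by metis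
  have dense: "dense_in T D" using D gdelta_dense_imp_dense by blast
  have tbD: "D.totally_bounded" using totally_bounded_dense_subgroup T D(1) dense by blast
  \<comment> \<open>Were h trivial on the trace of B on D, finitely many translates of that trace
    would cover D, and H would be finite.\<close>
  have ex: "\<exists>e\<in>D \<inter> B. h e \<noteq> \<one>\<^bsub>H\<^esub>" if B: "openin T B" "\<one> \<in> B" for B
  proof (rule ccontr)
    assume no: "\<not> ?thesis"
    have "openin (subtopology T D) (B \<inter> D)" "\<one>\<^bsub>G\<lparr>carrier := D\<rparr>\<^esub> \<in> B \<inter> D"
      using B D1 by (auto simp: openin_subtopology)
    then obtain F where F: "finite F" "F \<subseteq> D" "D \<subseteq> (\<Union>f\<in>F. f <#\<^bsub>G\<lparr>carrier := D\<rparr>\<^esub> (B \<inter> D))"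
      using D.totally_boundedD[OF tbD, of "B \<inter> D"] by auto
    have "carrier H \<subseteq> h ` F"
    proof
      fix y assume "y \<in> carrier H"
      then obtain x where x: "x \<in> D" "y = h x" using hom by blast
      then obtain f b where f: "f \<in> F" "b \<in> B \<inter> D" "x = f \<otimes> b"
        using F(3) by (fastforce simp: l_coset_def)
      then have "h b = \<one>\<^bsub>H\<^esub>" using no by blast
      then have "y = h f" using x f F hom(2)[of f] hom(3)[of f b] by auto
      then show "y \<in> h ` F" using f by blast
    qed
    then show False using inf F finite_surj by blast
  qed
  \<comment> \<open>A node of the scheme is a translate of B; its two children are the corresponding
    translates of B' and of e B'. In Q the closures of both children stay inside the parent, and the
    last clause separates their h-images on D.\<close>
  define P where "P = (\<lambda>(B, e). openin T B \<and> \<one> \<in> B \<and> e \<in> D \<inter> B \<and> h e \<noteq> \<one>\<^bsub>H\<^esub>)"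
  define Q where "Q = (\<lambda>(B, e) (B', e' :: 'a). T closure_of B' \<subseteq> B \<and> e <# (T closure_of B') \<subseteq> B \<and>
      (\<forall>x\<in>D \<inter> B'. \<forall>y\<in>D \<inter> B'. h x \<noteq> h (e \<otimes> y)))"
  have "\<exists>s. \<forall>n::nat. P (s n) \<and> Q (s n) (s (Suc n))"
  proof (rule dependent_nat_choice)
    obtain e where "e \<in> D \<inter> carrier G" "h e \<noteq> \<one>\<^bsub>H\<^esub>"
      using ex[of "carrier G"] by (metis one_closed openin_topspace topspace_eq)
    then show "\<exists>p. P p" by (intro exI[of _ "(carrier G, e)"]) (auto simp: P_def simp flip: topspace_eq, simp add: topspace_eq)
  next
    fix p and n :: nat assume "P p"
    then obtain B e where p: "p = (B, e)" and B: "openin T B" "\<one> \<in> B" and e: "e \<in> D" "e \<in> B" "h e \<noteq> \<one>\<^bsub>H\<^esub>"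
      by (cases p) (auto simp: P_def)
    have eG: "e \<in> carrier G" using e DG by blast
    have BG: "B \<subseteq> carrier G" using B openin_subset_carrier by blast
    obtain V1 V2 where V: "openin S V1" "openin S V2" "\<one>\<^bsub>H\<^esub> \<in> V1" "h e \<in> V2" "disjnt V1 V2"
      using H.Hausdorff e hom H.topspace_eq unfolding Hausdorff_space_def
      by (metis H.one_closed)
    let ?W1 = "{x \<in> topspace (subtopology T D). h x \<in> V1}"
    let ?W2 = "{x \<in> topspace (subtopology T D). h x \<in> V2}"
    obtain N1 where N1: "openin T N1" "?W1 = N1 \<inter> D"
      using openin_continuous_map_preimage[OF h(2) V(1)] by (auto simp: openin_subtopology)
    obtain N2 where N2: "openin T N2" "?W2 = N2 \<inter> D"
      using openin_continuous_map_preimage[OF h(2) V(2)] by (auto simp: openin_subtopology)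
    have "\<one> \<in> ?W1" using V D1 hom by (simp add: topspace_eq)
    then have 1: "\<one> \<in> N1" using N1 by blast
    have "e \<in> ?W2" using V e eG by (simp add: topspace_eq)
    then have 2: "e \<in> N2" using N2 by blast
    \<comment> \<open>The four factors put, in this order, the left child into B, the right child
      into B, the h-image of the left child into V1 and that of the right child into V2, the images
      being taken within D.\<close>
    define O' where "O' = B \<inter> (inv e <# B) \<inter> N1 \<inter> (inv e <# N2)"
    have NG: "N2 \<subseteq> carrier G" using N2 openin_subset_carrier by blast
    have oO: "openin T O'" unfolding O'_def
      using B N1 N2 eG by (intro openin_Int openin_l_coset) auto
    moreover have "\<one> \<in> O'" unfolding O'_def
      using B 1 2 eG e by (simp add: l_coset_eq_vimage[OF BG] l_coset_eq_vimage[OF NG])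
    ultimately obtain B' where B': "openin T B'" "\<one> \<in> B'" "T closure_of B' \<subseteq> O'"
      using nbhd_closure by metis
    have B'O: "B' \<subseteq> O'" using B' closure_of_subset[OF openin_subset[OF B'(1)]] by blast
    obtain e' where e': "e' \<in> D \<inter> B'" "h e' \<noteq> \<one>\<^bsub>H\<^esub>" using ex[OF B'(1,2)] by blast
    have eO: "e \<otimes> y \<in> B" "e \<otimes> y \<in> N2" if "y \<in> O'" for y
      using that eG by (auto simp: O'_def l_coset_eq_vimage[OF BG] l_coset_eq_vimage[OF NG])
    have "Q p (B', e')"
      unfolding Q_def p split
    proof (intro conjI ballI notI)
      show "T closure_of B' \<subseteq> B" using B' unfolding O'_def by blast
      show "e <# (T closure_of B') \<subseteq> B" using B'(3) eO(1) by (auto simp: l_coset_def)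
      fix x y assume x: "x \<in> D \<inter> B'" and y: "y \<in> D \<inter> B'" and eq: "h x = h (e \<otimes> y)"
      have "x \<in> ?W1" using x B'O N1 unfolding O'_def by blast
      then have 3: "h x \<in> V1" by blast
      have "e \<otimes> y \<in> N2 \<inter> D" using eO(2) y B'O mD e by blast
      then have "e \<otimes> y \<in> ?W2" using N2 by blast
      then have "h (e \<otimes> y) \<in> V2" by blast
      then show False using V(5) 3 eq by (auto simp: disjnt_def)
    qed
    moreover have "P (B', e')" using B' e' by (auto simp: P_def)
    ultimately show "\<exists>y. P y \<and> Q p y" by blast
  qed
  then obtain s where s: "\<And>n. P (s n)" "\<And>n. Q (s n) (s (Suc n))" by blast
  define B where "B n = fst (s n)" for n
  define e where "e n = snd (s n)" for n
  have se: "s n = (B n, e n)" for n by (simp add: B_def e_def)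
  have B: "openin T (B n)" "\<one> \<in> B n" and e: "e n \<in> D" "e n \<in> B n" for n
    using s(1)[of n] by (auto simp: P_def se)
  have cl: "T closure_of (B (Suc n)) \<subseteq> B n" "e n <# (T closure_of B (Suc n)) \<subseteq> B n"
    and sep: "\<And>x y. x \<in> D \<inter> B (Suc n) \<Longrightarrow> y \<in> D \<inter> B (Suc n) \<Longrightarrow> h x \<noteq> h (e n \<otimes> y)" for n
    using s(2)[of n] by (auto simp: Q_def se)
  have BG: "B n \<subseteq> carrier G" for n using B openin_subset_carrier by blast
  \<comment> \<open>\<open>d t n\<close> is the product of the \<open>e k\<close> with k in t and k
    < n, in increasing order; the branch t has the node \<open>d t n <# B n\<close> at level
    n.\<close>
  define d where "d t n = rec_nat \<one> (\<lambda>k x. x \<otimes> (if k \<in> t then e k else \<one>)) n" for t :: "nat set" and n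
  have d0: "d t 0 = \<one>" and dS: "d t (Suc n) = d t n \<otimes> (if n \<in> t then e n else \<one>)" for t n
    by (simp_all add: d_def)
  have dD: "d t n \<in> D" for t n by (induction n) (auto simp: d0 dS D1 e mD)
  then have dG: "d t n \<in> carrier G" for t n using DG by blast
  have clG: "T closure_of (B n) \<subseteq> carrier G" for n by (simp add: closure_of_subset_topspace flip: topspace_eq)
  have step: "d t (Suc n) <# (T closure_of B (Suc n)) \<subseteq> d t n <# B n" for t n
  proof
    fix x assume "x \<in> d t (Suc n) <# (T closure_of B (Suc n))"
    then obtain b where b: "b \<in> T closure_of B (Suc n)" "x = d t (Suc n) \<otimes> b" by (auto simp: l_coset_def)
    have bG: "b \<in> carrier G" using b clG by blast
    let ?a = "if n \<in> t then e n else \<one>"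
    have "x = d t n \<otimes> (?a \<otimes> b)" using b bG dG[of t n] DG e(1)[of n] by (auto simp: dS m_assoc)
    moreover have "?a \<otimes> b \<in> B n" using cl(1)[of n] cl(2)[of n] b(1) bG by (auto simp: l_coset_def)
    ultimately show "x \<in> d t n <# B n" by (auto simp: l_coset_def)
  qed
  have "\<exists>y. y \<in> D \<and> (\<forall>n. y \<in> d t n <# B n)" for t
  proof -
    define C where "C n = d t n <# (T closure_of B n)" for n
    have sub: "d t n <# B n \<subseteq> C n" for n
      using closure_of_subset[OF openin_subset[OF B(1)[of n]]] by (auto simp: C_def l_coset_def)
    have "(\<Inter>n. C n) \<noteq> {}"
    proof (rule compact_space_imp_nest[OF T])
      show "closedin T (C n)" for n unfolding C_def using dG by (intro closedin_l_coset) auto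
      show "C n \<noteq> {}" for n using sub[of n] B(2)[of n] by (auto simp: l_coset_def)
      show "decseq C" using step sub unfolding decseq_Suc_iff C_def by blast
    qed
    then obtain x where x: "\<And>n. x \<in> C n" by blast
    have xB: "x \<in> d t n <# B n" for n using x[of "Suc n"] step[of t n] unfolding C_def by blast
    have "gdelta_in T (\<Inter>(range (\<lambda>n. d t n <# B n)))"
      using B(1) dG by (intro gdelta_in_Inter) (auto intro!: open_imp_gdelta_in openin_l_coset)
    then have "D \<inter> \<Inter>(range (\<lambda>n. d t n <# B n)) \<noteq> {}"
      using D(2) xB unfolding gdelta_dense_in_def by blast
    then show ?thesis by blast
  qed
  then obtain y where yD: "\<And>t. y t \<in> D" and y: "\<And>t n. y t \<in> d t n <# B n" by metis
  \<comment> \<open>At n, the first place where the branches part, t turns left and t' right; the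
    common prefix \<open>d t n\<close> cancels, and \<open>sep\<close> applies.\<close>
  have neq: "h (y t) \<noteq> h (y t')" if lt: "\<And>k. k < n \<Longrightarrow> k \<in> t \<longleftrightarrow> k \<in> t'" and nt: "n \<notin> t" "n \<in> t'" for n t t'
  proof
    assume eq: "h (y t) = h (y t')"
    have "d t m = d t' m" if "m \<le> n" for m
      using that lt by (induction m) (auto simp: d0 dS)
    then have dn: "d t' n = d t n" by simp
    obtain b where b: "b \<in> B (Suc n)" "y t = d t n \<otimes> b"
      using y[of t "Suc n"] nt(1) dG by (auto simp: l_coset_def dS)
    obtain b' where b': "b' \<in> B (Suc n)" "y t' = d t n \<otimes> (e n \<otimes> b')"
    proof -
      obtain b' where "b' \<in> B (Suc n)" "y t' = d t n \<otimes> e n \<otimes> b'"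
        using y[of t' "Suc n"] nt(2) dn by (auto simp: l_coset_def dS)
      moreover from this have "b' \<in> carrier G" using BG by blast
      ultimately show thesis using that[of b'] dG[of t n] e(1)[of n] DG by (simp add: m_assoc subset_iff)
    qed
    \<comment> \<open>\<open>sep\<close> speaks of points of D, whereas the remainders b and b' come
      only from B. The prefix lies in D, and so do the end points, so cancelling brings the
      remainders into D.\<close>
    have cancel: "z \<in> D" if "d t n \<otimes> z \<in> D" "z \<in> carrier G" for z
    proof -
      have "inv (d t n) \<otimes> (d t n \<otimes> z) \<in> D" using that dD D(1) by (simp add: subgroup.m_closed subgroup.m_inv_closed)
      then show ?thesis using that dG by (simp flip: m_assoc)
    qed
    have eG: "e n \<in> carrier G" "b \<in> carrier G" "b' \<in> carrier G"
      using e(1) DG b b' BG by blast+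
    have bD: "b \<in> D" using cancel[of b] b yD[of t] eG by simp
    have ebD: "e n \<otimes> b' \<in> D" using cancel[of "e n \<otimes> b'"] b' yD[of t'] eG by simp
    have "inv (e n) \<otimes> (e n \<otimes> b') \<in> D" using ebD e(1) D(1) by (simp add: subgroup.m_closed subgroup.m_inv_closed)
    then have bD': "b' \<in> D" using eG by (simp flip: m_assoc)
    have "h (d t n) \<otimes>\<^bsub>H\<^esub> h b = h (d t n) \<otimes>\<^bsub>H\<^esub> h (e n \<otimes> b')"
      using eq b b' hom(3)[OF dD bD] hom(3)[OF dD ebD] by simp
    then have "h b = h (e n \<otimes> b')"
      using hom(2) bD ebD dD by simp
    then show False using sep[of b n b'] b b' bD bD' by blast
  qed
  have "inj_on (\<lambda>t. h (y t)) UNIV"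
  proof (rule injI, rule ccontr)
    fix t t' assume eq: "h (y t) = h (y t')" and "t \<noteq> t'"
    then have ex: "\<exists>n. (n \<in> t) \<noteq> (n \<in> t')" by blast
    define n where "n = (LEAST n. (n \<in> t) \<noteq> (n \<in> t'))"
    have n: "(n \<in> t) \<noteq> (n \<in> t')" "\<And>k. k < n \<Longrightarrow> k \<in> t \<longleftrightarrow> k \<in> t'"
      unfolding n_def using LeastI_ex[OF ex] not_less_Least by blast+
    then show False using eq neq[of n t t'] neq[of n t' t] by (cases "n \<in> t") auto
  qed
  moreover have "(\<lambda>t. h (y t)) ` UNIV \<subseteq> carrier H" using yD hom by blast
  ultimately have "|UNIV :: nat set set| \<le>o |carrier H|" using card_of_ordLeq by blast
  moreover have "|UNIV :: real set| \<le>o |UNIV :: nat set set|"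
    using eqpoll_imp_lepoll[OF eqpoll_sym[OF nat_sets_eqpoll_reals]] unfolding lepoll_def card_of_ordLeq .
  ultimately show ?thesis using ordLeq_transitive by blast
qed

theorem gdelta_dense_imp_projectively_arhangelskii:
  assumes T: "compact_space T" and D: "subgroup D G" "gdelta_dense_in T D"
    and w: "weight T \<le>o |UNIV :: real set|"
  shows "projectively_arhangelskii (G\<lparr>carrier := D\<rparr>) (subtopology T D)"
  unfolding projectively_arhangelskii_def
proof (intro allI impI, elim conjE)
  fix H :: "'a monoid" and S h
  assume H: "topological_group H S" "h \<in> epi (G\<lparr>carrier := D\<rparr>) H"
    "continuous_map (subtopology T D) S h"
  interpret H: topological_group H S by (fact H)
  show "arhangelskii S"
  \<comment> \<open>A finite image escapes the lower bound by the continuum. It is harmless because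
    weights are not rounded up: the singletons form a base.\<close>
  proof (cases "finite (topspace S)")
    case True
    then show ?thesis unfolding arhangelskii_def using weight_finite_Hausdorff H.Hausdorff by blast
  next
    case False
    have "weight S \<le>o |UNIV :: real set|"
      using weight_image_le[OF T D(1) gdelta_dense_imp_dense[OF D(2)] H _ w] infinite_UNIV_char_0 by blast
    moreover have "|UNIV :: real set| \<le>o |topspace S|"
      using gdelta_dense_image_ge_continuum[OF T D H] False unfolding H.topspace_eq by blast
    ultimately show ?thesis unfolding arhangelskii_def using ordLeq_transitive by blast
  qed
qed

end

section \<open>Small dense sets modulo large quotients\<close>

text \<open>W and the complements of the C_i form an open cover. The factor
  \<open>topspace X\<close> gives the intersection over an empty index set its right
  meaning.\<close>

lemma compact_INT_subset:
  assumes X: "compact_space X" and C: "\<And>i. i \<in> I \<Longrightarrow> closedin X (C i)" and W: "openin X W"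
    and sub: "topspace X \<inter> (\<Inter>i\<in>I. C i) \<subseteq> W"
  obtains F where "finite F" "F \<subseteq> I" "topspace X \<inter> (\<Inter>i\<in>F. C i) \<subseteq> W"
proof -
  let ?f = "\<lambda>i. topspace X - C i"
  let ?\<U> = "insert W (?f ` I)"
  have "\<forall>U\<in>?\<U>. openin X U" using C W by auto
  moreover have "topspace X \<subseteq> \<Union>?\<U>" using sub by auto
  ultimately obtain \<F> where \<F>: "finite \<F>" "\<F> \<subseteq> ?\<U>" "topspace X \<subseteq> \<Union>\<F>"
    using X[unfolded compact_space_alt, rule_format, of ?\<U>] by blast
  then have "finite (\<F> - {W})" "\<F> - {W} \<subseteq> ?f ` I" by auto
  then have "\<exists>F\<subseteq>I. finite F \<and> \<F> - {W} = ?f ` F" by (rule finite_subset_image)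
  then obtain F where F: "F \<subseteq> I" "finite F" "\<F> - {W} = ?f ` F" by (elim exE conjE)
  have "topspace X \<inter> (\<Inter>i\<in>F. C i) \<subseteq> W"
  proof
    fix x assume x: "x \<in> topspace X \<inter> (\<Inter>i\<in>F. C i)"
    then obtain U where "U \<in> \<F>" "x \<in> U" using \<F>(3) by blast
    show "x \<in> W"
    proof (cases "U = W")
      case False
      then have "U \<in> ?f ` F" using \<open>U \<in> \<F>\<close> F(3) by blast
      then show ?thesis using x \<open>x \<in> U\<close> by blast
    qed (use \<open>x \<in> U\<close> in simp)
  qed
  then show thesis using that F by blast
qed

text \<open>Recursion along a well-order of the index type of least possible order type: before each
  stage fewer values than the size of that type have been taken, so A_i still offers a new
  one.\<close>

lemma inj_choice_of_large_sets:
  fixes A :: "'i \<Rightarrow> 'b set"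
  assumes large: "\<And>i. |UNIV :: 'i set| \<le>o |A i|"
  obtains f where "inj f" "\<And>i. f i \<in> A i"
proof -
  let ?r = "|UNIV :: 'i set|"
  have co: "Card_order ?r" by (rule card_of_Card_order)
  have wo: "Well_order ?r" by (rule card_of_Well_order)
  have "wf (?r - Id)" using wo well_order_on_def by blast
  then have "\<exists>f. \<forall>i. f i \<in> A i \<and> f i \<notin> f ` {k. (k, i) \<in> ?r - Id}"
  proof (rule dependent_wf_choice)
    fix f :: "'i \<Rightarrow> 'b" and g i v
    assume "\<And>z. (z, i) \<in> ?r - Id \<Longrightarrow> f z = g z"
    then have "f ` {k. (k, i) \<in> ?r - Id} = g ` {k. (k, i) \<in> ?r - Id}" by (intro image_cong) auto
    then show "(v \<in> A i \<and> v \<notin> f ` {k. (k, i) \<in> ?r - Id}) = (v \<in> A i \<and> v \<notin> g ` {k. (k, i) \<in> ?r - Id})"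
      by simp
  next
    fix i and f :: "'i \<Rightarrow> 'b"
    have eq: "{k. (k, i) \<in> ?r - Id} = underS ?r i" by (auto simp: underS_def)
    have "|f ` {k. (k, i) \<in> ?r - Id}| \<le>o |underS ?r i|" unfolding eq by (rule card_of_image)
    also have "|underS ?r i| <o ?r" using card_of_underS[OF co] by (simp add: Field_card_of)
    also have "?r \<le>o |A i|" by (rule large)
    finally have "|f ` {k. (k, i) \<in> ?r - Id}| <o |A i|" .
    then have "\<not> A i \<subseteq> f ` {k. (k, i) \<in> ?r - Id}"
      using card_of_mono1 not_ordLess_ordLeq by blast
    then show "\<exists>v. v \<in> A i \<and> v \<notin> f ` {k. (k, i) \<in> ?r - Id}" by blast
  qed
  then obtain f where f: "\<And>i. f i \<in> A i" "\<And>i. f i \<notin> f ` {k. (k, i) \<in> ?r - Id}" by blast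
  have "inj f"
  proof (rule injI, rule ccontr)
    fix i k assume "f i = f k" "i \<noteq> k"
    moreover have "(i, k) \<in> ?r \<or> (k, i) \<in> ?r"
      using wo \<open>i \<noteq> k\<close> unfolding well_order_on_def linear_order_on_def total_on_def
      by (simp add: Field_card_of)
    ultimately have "i \<in> {i. (i, k) \<in> ?r - Id} \<or> k \<in> {k. (k, i) \<in> ?r - Id}" by auto
    then show False using f(2)[of i] f(2)[of k] \<open>f i = f k\<close> by (metis (lifting) imageI)
  qed
  then show thesis using that f by blast
qed

section \<open>Arithmetic of the continuum\<close>

lemma surj_real_pair: obtains p :: "real \<Rightarrow> real \<times> real" where "surj p"
proof -
  have "|UNIV \<times> UNIV :: (real \<times> real) set| \<le>o |UNIV :: real set|"
    using card_of_Times_same_infinite[of "UNIV :: real set"] infinite_UNIV_char_0 ordIso_imp_ordLeq by blast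
  then have "\<exists>p :: real \<Rightarrow> real \<times> real. p ` UNIV = UNIV \<times> UNIV"
    by (subst card_of_ordLeq2) auto
  then show thesis using that by auto
qed

lemma card_of_countable_fun_real:
  "|UNIV :: ('k :: countable \<Rightarrow> real) set| \<le>o |UNIV :: real set|"
proof -
  obtain b :: "real \<Rightarrow> nat set" where b: "inj b"
    using eqpoll_imp_lepoll[OF eqpoll_sym[OF nat_sets_eqpoll_reals]] unfolding lepoll_def by blast
  obtain c :: "nat set \<Rightarrow> real" where c: "inj c"
    using eqpoll_imp_lepoll[OF nat_sets_eqpoll_reals] unfolding lepoll_def by blast
  \<comment> \<open>The sets of naturals that code the values of g are packed into a single one by
    the pairing function.\<close>
  define \<phi> where "\<phi> g = {n. snd (prod_decode n) \<in> b (g (from_nat (fst (prod_decode n))))}"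
    for g :: "'k \<Rightarrow> real"
  have "inj \<phi>"
  proof (rule injI, rule ext)
    fix g h k assume eq: "\<phi> g = \<phi> h"
    have "m \<in> b (g k) \<longleftrightarrow> prod_encode (to_nat k, m) \<in> \<phi> g" for g m by (simp add: \<phi>_def)
    then have "b (g k) = b (h k)" using eq by blast
    then show "g k = h k" using b by (simp add: inj_eq)
  qed
  then have "inj (c \<circ> \<phi>)" using c by (simp add: inj_compose)
  then show ?thesis using card_of_ordLeq by blast
qed

lemma card_of_finite_subsets_real: "|Collect finite :: real set set| \<le>o |UNIV :: real set|"
proof -
  \<comment> \<open>A sequence codes a finite set: its term at 0 tells how many entries to read, and
    the entries follow, shifted by one place.\<close>
  let ?f = "\<lambda>s :: nat \<Rightarrow> real. (\<lambda>i. s (Suc i)) ` {..<nat \<lfloor>s 0\<rfloor>}"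
  have "Collect finite \<subseteq> range ?f"
  proof clarify
    fix F :: "real set" assume "finite F"
    then obtain n :: nat and f where "F = f ` {i. i < n}"
      using finite_imp_nat_seg_image_inj_on by metis
    then have "F = ?f (case_nat (real n) f)" by (auto simp: lessThan_def)
    then show "F \<in> range ?f" by blast
  qed
  then have "|Collect finite :: real set set| \<le>o |range ?f|" by (rule card_of_mono1)
  also have "|range ?f| \<le>o |UNIV :: (nat \<Rightarrow> real) set|" by (rule card_of_image)
  also have "|UNIV :: (nat \<Rightarrow> real) set| \<le>o |UNIV :: real set|" by (rule card_of_countable_fun_real)
  finally show ?thesis .
qed

text \<open>Lets a countable family be reindexed by the reals, the index type fixed in
  \<open>continuum_intersection\<close>.\<close>

lemma surj_real_nat: "surj (\<lambda>r::real. nat \<lfloor>r\<rfloor>)"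
  by (rule surjI[of _ real]) simp

section \<open>Neighbourhoods and closed normal subgroups of compact groups\<close>

context topological_group
begin

lemma continuous_map_group_mult:
  assumes "continuous_map X T f" "continuous_map X T g"
  shows "continuous_map X T (\<lambda>x. f x \<otimes> g x)"
proof -
  have "continuous_map X (prod_topology T T) (\<lambda>x. (f x, g x))"
    using assms by (simp add: continuous_map_pairedI)
  from continuous_map_compose[OF this continuous_mult] show ?thesis by (simp add: o_def)
qed

lemma continuous_map_group_inv:
  assumes "continuous_map X T f"
  shows "continuous_map X T (\<lambda>x. inv f x)"
  using continuous_map_compose[OF assms continuous_inv] by (simp add: o_def)

lemma closedin_set_mult:
  assumes "compact_space T" "closedin T A" "closedin T B"
  shows "closedin T (A <#> B)"
proof -
  have "compactin (prod_topology T T) (A \<times> B)"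
    using assms by (simp add: compactin_Times closedin_compact_space)
  then have "compactin T ((\<lambda>(x, y). x \<otimes> y) ` (A \<times> B))"
    using image_compactin continuous_mult by blast
  moreover have "(\<lambda>(x, y). x \<otimes> y) ` (A \<times> B) = A <#> B"
    by (auto simp: set_mult_def)
  ultimately show ?thesis using Hausdorff compactin_imp_closedin by metis
qed

text \<open>The obstruction is (G - U) C^{-1}, which is closed as a product of two compact sets and
  misses 1 because C lies in U. Its complement is the required V.\<close>

lemma nbhd_mult_closed:
  assumes T: "compact_space T" and C: "closedin T C" and U: "openin T U" "C \<subseteq> U"
  obtains V where "openin T V" "\<one> \<in> V" "\<And>v c. v \<in> V \<Longrightarrow> c \<in> C \<Longrightarrow> v \<otimes> c \<in> U"
proof -
  let ?C' = "{x \<in> topspace T. inv x \<in> C}"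
  let ?V = "topspace T - ((topspace T - U) <#> ?C')"
  have CG: "C \<subseteq> carrier G" using C closedin_subset_carrier by blast
  have "closedin T ?C'" using closedin_continuous_map_preimage[OF continuous_inv C] .
  then have "closedin T ((topspace T - U) <#> ?C')" using U by (intro closedin_set_mult T) auto
  then have o: "openin T ?V" by blast
  have one: "\<one> \<in> ?V"
  proof -
    have "\<one> \<notin> (topspace T - U) <#> ?C'"
    proof
      assume "\<one> \<in> (topspace T - U) <#> ?C'"
      then obtain x y where xy: "x \<in> carrier G" "x \<notin> U" "y \<in> carrier G" "inv y \<in> C" "\<one> = x \<otimes> y"
        by (auto simp: set_mult_def topspace_eq)
      then have "x = inv y" by (metis inv_equality inv_inv)
      then show False using xy U by blast
    qed
    then show ?thesis by (simp add: topspace_eq)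
  qed
  show thesis
  proof (rule that[OF o one], rule ccontr)
    fix v c assume v: "v \<in> ?V" and c: "c \<in> C" and n: "v \<otimes> c \<notin> U"
    have vc: "v \<in> carrier G" "c \<in> carrier G" using v c CG by (auto simp: topspace_eq)
    have "v = (v \<otimes> c) \<otimes> inv c" using vc by (simp add: m_assoc)
    moreover have "v \<otimes> c \<in> topspace T - U" "inv c \<in> ?C'" using vc n c by (auto simp: topspace_eq)
    ultimately have "v \<in> (topspace T - U) <#> ?C'" unfolding set_mult_def by blast
    then show False using v by blast
  qed
qed

text \<open>V is the intersection of all conjugates of U. It is open because its complement is the
  image, under conjugation, of the compact product of G - U with G.\<close>

lemma nbhd_conj_invariant:
  assumes T: "compact_space T" and U: "openin T U" "\<one> \<in> U"
  obtains V where "openin T V" "\<one> \<in> V" "V \<subseteq> U" "\<And>v g. v \<in> V \<Longrightarrow> g \<in> carrier G \<Longrightarrow> g \<otimes> v \<otimes> inv g \<in> V"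
proof -
  let ?f = "\<lambda>p. inv (snd p) \<otimes> fst p \<otimes> snd p"
  let ?A = "?f ` ((topspace T - U) \<times> topspace T)"
  let ?V = "topspace T - ?A"
  have "continuous_map (prod_topology T T) T ?f"
    by (intro continuous_map_group_mult continuous_map_group_inv continuous_map_fst continuous_map_snd)
  moreover have "compactin (prod_topology T T) ((topspace T - U) \<times> topspace T)"
    using T U by (simp add: compactin_Times closedin_compact_space closedin_diff)
  ultimately have "compactin T ?A" using image_compactin by blast
  then have "closedin T ?A" using Hausdorff compactin_imp_closedin by blast
  then have o: "openin T ?V" by blast
  have iff: "v \<in> ?V \<longleftrightarrow> v \<in> carrier G \<and> (\<forall>g\<in>carrier G. g \<otimes> v \<otimes> inv g \<in> U)" for v
  proof -
    have "v \<in> ?A \<longleftrightarrow> (\<exists>g\<in>carrier G. g \<otimes> v \<otimes> inv g \<notin> U)" if v: "v \<in> carrier G"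
    proof
      assume "v \<in> ?A"
      then obtain x g where xg: "x \<in> carrier G" "x \<notin> U" "g \<in> carrier G" "v = inv g \<otimes> x \<otimes> g"
        by (auto simp: topspace_eq)
      then have "g \<otimes> v \<otimes> inv g = x" by (simp add: m_assoc flip: m_assoc[of g "inv g"])
      then show "\<exists>g\<in>carrier G. g \<otimes> v \<otimes> inv g \<notin> U" using xg by blast
    next
      assume "\<exists>g\<in>carrier G. g \<otimes> v \<otimes> inv g \<notin> U"
      then obtain g where g: "g \<in> carrier G" "g \<otimes> v \<otimes> inv g \<notin> U" by blast
      then have "v = ?f (g \<otimes> v \<otimes> inv g, g)" using v by (simp add: m_assoc flip: m_assoc[of "inv g" g])
      moreover have "(g \<otimes> v \<otimes> inv g, g) \<in> (topspace T - U) \<times> topspace T" using g v by (simp add: topspace_eq)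
      ultimately show "v \<in> ?A" by (rule image_eqI)
    qed
    then show ?thesis by (auto simp: topspace_eq)
  qed
  show thesis
  proof (rule that[OF o])
    show "\<one> \<in> ?V" unfolding iff using U by simp
    show "?V \<subseteq> U"
    proof
      fix v assume "v \<in> ?V"
      then have "v \<in> carrier G" "\<one> \<otimes> v \<otimes> inv \<one> \<in> U" unfolding iff by (blast, blast)
      then show "v \<in> U" by simp
    qed
    fix v g assume v: "v \<in> ?V" and g: "g \<in> carrier G"
    have vG: "v \<in> carrier G" using v iff by blast
    have "k \<otimes> (g \<otimes> v \<otimes> inv g) \<otimes> inv k \<in> U" if k: "k \<in> carrier G" for k
    proof -
      have "(k \<otimes> g) \<otimes> v \<otimes> inv (k \<otimes> g) \<in> U" using v k g iff by blast
      then show ?thesis using k g vG by (simp add: inv_mult_group m_assoc)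
    qed
    then show "g \<otimes> v \<otimes> inv g \<in> ?V" unfolding iff using vG g by simp
  qed
qed

text \<open>Since there are as many finite subsets of the reals as reals, for a closed subgroup of a
  compact group being an intersection of continuum many open sets amounts to its quotient having
  weight at most the continuum.\<close>

definition continuum_intersection :: "'a set \<Rightarrow> bool" where
  "continuum_intersection M \<longleftrightarrow> (\<exists>U :: real \<Rightarrow> 'a set. (\<forall>r. openin T (U r)) \<and> M = (\<Inter>r. U r))"

lemma continuum_intersection_carrier: "continuum_intersection (carrier G)"
  unfolding continuum_intersection_def using openin_topspace[of T] topspace_eq
  by (intro exI[of _ "\<lambda>r. carrier G"]) auto

lemma continuum_intersection_INT:
  assumes "I \<noteq> {}" "|I| \<le>o |UNIV :: real set|" "\<And>i. i \<in> I \<Longrightarrow> continuum_intersection (M i)"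
  shows "continuum_intersection (\<Inter>i\<in>I. M i)"
proof -
  obtain U where U: "\<And>i r. i \<in> I \<Longrightarrow> openin T (U i (r::real))" "\<And>i. i \<in> I \<Longrightarrow> M i = (\<Inter>r. U i r)"
    using assms(3) unfolding continuum_intersection_def by metis
  obtain f where f: "f ` (UNIV :: real set) = I" using assms(1,2) card_of_ordLeq2 by metis
  obtain p :: "real \<Rightarrow> real \<times> real" where p: "surj p" using surj_real_pair by blast
  have "(\<Inter>i\<in>I. M i) = (\<Inter>q. U (f (fst q)) (snd q))"
    using U f by auto
  also have "\<dots> = (\<Inter>q\<in>range p. U (f (fst q)) (snd q))" using p by simp
  also have "\<dots> = (\<Inter>r. U (f (fst (p r))) (snd (p r)))" by auto
  finally show ?thesis
    unfolding continuum_intersection_def using U f by (intro exI[of _ "\<lambda>r. U (f (fst (p r))) (snd (p r))"]) auto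
qed

lemma continuum_intersection_Int:
  assumes "continuum_intersection M" "continuum_intersection N"
  shows "continuum_intersection (M \<inter> N)"
proof -
  have "|{M, N}| \<le>o |UNIV :: real set|"
    by (intro ordLess_imp_ordLeq finite_ordLess_infinite[OF card_of_Well_order card_of_Well_order])
      (simp_all add: Field_card_of infinite_UNIV_char_0)
  then show ?thesis using continuum_intersection_INT[of "{M, N}" "\<lambda>x. x"] assms by auto
qed

definition closed_normal :: "'a set \<Rightarrow> bool" where
  "closed_normal M \<longleftrightarrow> M \<lhd> G \<and> closedin T M"

lemma closed_normal_subgroup:
  assumes "closed_normal M"
  shows "subgroup M G" "M \<subseteq> carrier G" "\<one> \<in> M" "closedin T M"
  using assms normal_imp_subgroup subgroup.subset subgroup.one_closed unfolding closed_normal_def by blast+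

text \<open>For an empty index set the factor \<open>carrier G\<close> makes the intersection the
  whole group, from which the first stage of the transfinite chain is cut out.\<close>

lemma closed_normal_INT:
  assumes "\<And>i. i \<in> I \<Longrightarrow> closed_normal (M i)"
  shows "closed_normal (carrier G \<inter> (\<Inter>i\<in>I. M i))"
proof -
  have n: "subgroup (M i) G" "\<And>x h. x \<in> carrier G \<Longrightarrow> h \<in> M i \<Longrightarrow> x \<otimes> h \<otimes> inv x \<in> M i"
    "closedin T (M i)" if "i \<in> I" for i
    using assms[OF that] unfolding closed_normal_def normal_inv_iff by auto
  have "subgroup (carrier G \<inter> (\<Inter>i\<in>I. M i)) G"
    by (rule subgroupI) (use n in \<open>auto simp: subgroup.one_closed subgroup.m_closed subgroup.m_inv_closed\<close>)
  moreover have "closedin T (carrier G \<inter> (\<Inter>i\<in>I. M i))"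
  proof -
    have "closedin T (\<Inter>(insert (topspace T) (M ` I)))" using n by (intro closedin_Inter) auto
    then show ?thesis by (simp add: topspace_eq)
  qed
  ultimately show ?thesis unfolding closed_normal_def normal_inv_iff using n by auto
qed

lemma closed_normal_Int:
  assumes "closed_normal M" "closed_normal N"
  shows "closed_normal (M \<inter> N)"
proof -
  have "carrier G \<inter> (M \<inter> N) = M \<inter> N" using closed_normal_subgroup(2)[OF assms(1)] by blast
  moreover have "closed_normal (carrier G \<inter> (\<Inter>i\<in>{M, N}. i))"
    using assms by (intro closed_normal_INT) auto
  ultimately show ?thesis by simp
qed

end

section \<open>Bases and dense families modulo a closed normal subgroup\<close>

context topological_group
begin

lemma totally_bounded_compact:
  assumes "compact_space T"
  shows "totally_bounded"
proof -
  have "dense_in T (carrier G)" by (simp add: dense_in_def flip: topspace_eq)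
  moreover have "G\<lparr>carrier := carrier G\<rparr> = G" by simp
  moreover have "subtopology T (carrier G) = T" by (simp flip: topspace_eq)
  ultimately show ?thesis using totally_bounded_dense_subgroup[OF assms subgroup_self] by simp
qed

text \<open>After shrinking, finite intersections of the c many open sets that cut out Q become
  arbitrarily small around Q, by compactness, and there are only c many of them. Their translates
  act as a base of G/Q written in terms of open subsets of G.\<close>

lemma continuum_base_translates:
  assumes T: "compact_space T" and Q: "closed_normal Q" "continuum_intersection Q"
  obtains \<B> where "|\<B>| \<le>o |UNIV :: real set|" "\<And>B. B \<in> \<B> \<Longrightarrow> openin T B"
    "\<And>g U. g \<in> carrier G \<Longrightarrow> openin T U \<Longrightarrow> g <# Q \<subseteq> U \<Longrightarrow> \<exists>B\<in>\<B>. g \<in> B \<and> B <#> Q \<subseteq> U"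
proof -
  note Q' = closed_normal_subgroup[OF Q(1)]
  have normal: "x \<otimes> h \<otimes> inv x \<in> Q" if "x \<in> carrier G" "h \<in> Q" for x h
    using Q(1) that unfolding closed_normal_def normal_inv_iff by blast
  have norm: "normal_space T"
    using T Hausdorff compact_Hausdorff_or_regular_imp_normal_space by blast
  obtain O' where O': "\<And>r::real. openin T (O' r)" "Q = (\<Inter>r. O' r)"
    using Q(2) unfolding continuum_intersection_def by blast
  \<comment> \<open>The closures of the shrunken sets still intersect in Q, and being closed they
    are accessible to compactness.\<close>
  have "\<exists>V. openin T V \<and> Q \<subseteq> V \<and> T closure_of V \<subseteq> O' r" for r
    using norm[unfolded normal_space_alt, rule_format, of Q "O' r"] O' Q'(4) by blast
  then obtain V where V: "\<And>r. openin T (V r)" "\<And>r. Q \<subseteq> V r" "\<And>r. T closure_of V r \<subseteq> O' r"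
    by metis
  define W where "W F = carrier G \<inter> (\<Inter>r\<in>F. V r)" for F
  have QW: "Q \<subseteq> W F" for F using V Q' by (auto simp: W_def)
  show thesis
  proof (rule translates_base[OF totally_bounded_compact[OF T] infinite_UNIV_char_0, of "W ` Collect finite" Q])
    have "|W ` Collect finite| \<le>o |Collect finite :: real set set|" by (rule card_of_image)
    also have "|Collect finite :: real set set| \<le>o |UNIV :: real set|" by (rule card_of_finite_subsets_real)
    finally show "|W ` Collect finite| \<le>o |UNIV :: real set|" .
    show "Q \<subseteq> carrier G" by (rule Q')
  next
    fix A assume "A \<in> W ` Collect finite"
    then obtain F where F: "finite F" "A = W F" by auto
    have "openin T (\<Inter>(insert (topspace T) (V ` F)))"
      using F V by (intro openin_Inter) auto
    moreover have "\<one> \<in> A" using QW[of F] Q'(3) F(2) by blast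
    ultimately show "openin T A \<and> A \<noteq> {}" using F(2) by (auto simp: W_def topspace_eq)
  next
    fix U assume U: "openin T U" "Q \<subseteq> U"
    obtain U1 where U1: "openin T U1" "\<one> \<in> U1" "\<And>v c. v \<in> U1 \<Longrightarrow> c \<in> Q \<Longrightarrow> v \<otimes> c \<in> U"
      using nbhd_mult_closed[OF T Q'(4) U] by metis
    obtain U2 where U2: "openin T U2" "\<one> \<in> U2" "\<And>v. v \<in> U2 \<Longrightarrow> inv v \<in> U2"
      "\<And>v w. v \<in> U2 \<Longrightarrow> w \<in> U2 \<Longrightarrow> v \<otimes> w \<in> U1"
      using nbhd_symmetric[OF U1(1,2)] by metis
    have U2G: "U2 \<subseteq> carrier G" using U2 openin_subset_carrier by blast
    have oQ: "openin T (U2 <#> Q)" using U2 Q' openin_set_mult_right by blast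
    have "topspace T \<inter> (\<Inter>r\<in>UNIV. T closure_of V r) \<subseteq> U2 <#> Q"
    proof
      fix x assume "x \<in> topspace T \<inter> (\<Inter>r\<in>UNIV. T closure_of V r)"
      then have "x \<in> Q" using V(3) O'(2) by blast
      then have "x = \<one> \<otimes> x" using Q'(2) by auto
      then show "x \<in> U2 <#> Q" using U2(2) \<open>x \<in> Q\<close> unfolding set_mult_def by blast
    qed
    then obtain F where F: "finite F" "topspace T \<inter> (\<Inter>r\<in>F. T closure_of V r) \<subseteq> U2 <#> Q"
      using compact_INT_subset[OF T _ oQ, of UNIV "\<lambda>r. T closure_of V r"] by auto
    have "V r \<subseteq> T closure_of V r" for r using V(1) closure_of_subset openin_subset by metis
    then have WF: "W F \<subseteq> U2 <#> Q" using F(2) unfolding W_def topspace_eq by blast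
    have "inv v \<otimes> w \<otimes> q \<in> U" if vwq: "v \<in> W F" "w \<in> W F" "q \<in> Q" for v w q
    proof -
      obtain a p where ap: "a \<in> U2" "p \<in> Q" "v = a \<otimes> p" using vwq WF by (auto simp: set_mult_def)
      obtain b p' where bp: "b \<in> U2" "p' \<in> Q" "w = b \<otimes> p'" using vwq WF by (auto simp: set_mult_def)
      have c: "a \<in> carrier G" "b \<in> carrier G" "p \<in> carrier G" "p' \<in> carrier G" "q \<in> carrier G"
        using ap bp vwq U2G Q' by auto
      define u where "u = inv a \<otimes> b"
      have u: "u \<in> U1" "u \<in> carrier G" using U2 ap bp c by (auto simp: u_def)
      \<comment> \<open>Normality carries p^{-1} across u: p^{-1} u = u (u^{-1} p^{-1} u) with the
        bracket in Q. Hence v^{-1} w q lies in u Q, which is inside U.\<close>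
      have "inv u \<otimes> inv p \<otimes> inv (inv u) \<in> Q" using u ap Q' by (intro normal) (auto simp: subgroup.m_inv_closed)
      then have "(inv u \<otimes> inv p \<otimes> u) \<otimes> (p' \<otimes> q) \<in> Q"
        using bp vwq Q'(1) u by (simp add: subgroup.m_closed)
      then have "u \<otimes> ((inv u \<otimes> inv p \<otimes> u) \<otimes> (p' \<otimes> q)) \<in> U" using U1 u by blast
      moreover have "u \<otimes> ((inv u \<otimes> inv p \<otimes> u) \<otimes> (p' \<otimes> q)) = inv p \<otimes> u \<otimes> (p' \<otimes> q)"
        using c u(2) by (simp add: m_assoc[symmetric])
      moreover have "\<dots> = inv v \<otimes> w \<otimes> q"
        using c unfolding ap bp by (simp add: u_def inv_mult_group m_assoc)
      ultimately show ?thesis by simp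
    qed
    moreover have "W F \<in> W ` Collect finite" using F by auto
    ultimately show "\<exists>V\<in>W ` Collect finite. \<forall>v\<in>V. \<forall>w\<in>V. \<forall>q\<in>Q. inv v \<otimes> w \<otimes> q \<in> U" by blast
  next
    fix \<B> assume "|\<B>| \<le>o |UNIV :: real set|" "\<And>B. B \<in> \<B> \<Longrightarrow> openin T B"
      "\<And>g U. g \<in> carrier G \<Longrightarrow> openin T U \<Longrightarrow> g <# Q \<subseteq> U \<Longrightarrow> \<exists>B\<in>\<B>. g \<in> B \<and> B <#> Q \<subseteq> U"
    then show thesis by (rule that)
  qed
qed

lemma closed_normal_one: "closed_normal {\<one>}"
  unfolding closed_normal_def using one_is_normal Hausdorff
  by (simp add: closedin_Hausdorff_sing_eq topspace_eq)

lemma weight_le_of_continuum_intersection_one: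
  assumes T: "compact_space T" and "continuum_intersection {\<one>}"
  shows "weight T \<le>o |UNIV :: real set|"
proof -
  obtain \<B> where "|\<B>| \<le>o |UNIV :: real set|" "\<And>B. B \<in> \<B> \<Longrightarrow> openin T B"
    "\<And>g U. g \<in> carrier G \<Longrightarrow> openin T U \<Longrightarrow> g <# {\<one>} \<subseteq> U \<Longrightarrow> \<exists>B\<in>\<B>. g \<in> B \<and> B <#> {\<one>} \<subseteq> U"
    using continuum_base_translates[OF T closed_normal_one assms(2)] by metis
  then have "is_base T \<B>" "|\<B>| \<le>o |UNIV :: real set|" by (simp_all add: is_base_translates)
  then show ?thesis using weight_le ordLeq_transitive by blast
qed

text \<open>Take conjugation-invariant neighbourhoods of 1 that omit m, each containing the closure,
  the inverses and the products of the next. Their intersection is a closed normal subgroup and a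
  G_delta-set. This takes the place of separating points by representations.\<close>

lemma small_closed_normal_avoiding:
  assumes T: "compact_space T" and m: "m \<in> carrier G" "m \<noteq> \<one>"
  obtains P where "closed_normal P" "continuum_intersection P" "m \<notin> P"
proof -
  define p where "p U \<longleftrightarrow> openin T U \<and> \<one> \<in> U \<and> m \<notin> U \<and> (\<forall>v\<in>U. \<forall>g\<in>carrier G. g \<otimes> v \<otimes> inv g \<in> U)" for U
  define q where "q U U' \<longleftrightarrow> T closure_of U' \<subseteq> U \<and> (\<forall>v\<in>U'. inv v \<in> U) \<and> (\<forall>v\<in>U'. \<forall>w\<in>U'. v \<otimes> w \<in> U)" for U U'
  have "\<exists>U. \<forall>n::nat. p (U n) \<and> q (U n) (U (Suc n))"
  proof (rule dependent_nat_choice)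
    have "openin T (topspace T - {m})" using Hausdorff by (intro open_in_Hausdorff_delete) auto
    moreover have "\<one> \<in> topspace T - {m}" using m by (simp add: topspace_eq)
    ultimately obtain V where "openin T V" "\<one> \<in> V" "V \<subseteq> topspace T - {m}"
      "\<And>v g. v \<in> V \<Longrightarrow> g \<in> carrier G \<Longrightarrow> g \<otimes> v \<otimes> inv g \<in> V"
      using nbhd_conj_invariant[OF T] by metis
    then show "\<exists>U. p U" unfolding p_def by blast
  next
    fix U and n :: nat assume U: "p U"
    then have U': "openin T U" "\<one> \<in> U" by (auto simp: p_def)
    obtain V where V: "openin T V" "\<one> \<in> V" "V \<subseteq> U" "\<And>v. v \<in> V \<Longrightarrow> inv v \<in> V"
      "\<And>v w. v \<in> V \<Longrightarrow> w \<in> V \<Longrightarrow> v \<otimes> w \<in> U" using nbhd_symmetric[OF U'] by metis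
    obtain V' where V': "openin T V'" "\<one> \<in> V'" "T closure_of V' \<subseteq> V" using nbhd_closure[OF V(1,2)] by metis
    obtain W where W: "openin T W" "\<one> \<in> W" "W \<subseteq> V'"
      "\<And>v g. v \<in> W \<Longrightarrow> g \<in> carrier G \<Longrightarrow> g \<otimes> v \<otimes> inv g \<in> W"
      using nbhd_conj_invariant[OF T V'(1,2)] by metis
    have "V' \<subseteq> T closure_of V'" using V' closure_of_subset openin_subset by metis
    then have WV: "W \<subseteq> V" using W V' by blast
    have "T closure_of W \<subseteq> T closure_of V'" using W(3) by (rule closure_of_mono)
    then have "q U W" unfolding q_def using V V' WV by blast
    moreover have "p W" unfolding p_def using W WV V U by (auto simp: p_def)
    ultimately show "\<exists>W. p W \<and> q U W" by blast
  qed
  then obtain U where U: "\<And>n::nat. p (U n)" "\<And>n. q (U n) (U (Suc n))" by blast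
  have p: "openin T (U n)" "\<one> \<in> U n" "m \<notin> U n" "\<And>v g. v \<in> U n \<Longrightarrow> g \<in> carrier G \<Longrightarrow> g \<otimes> v \<otimes> inv g \<in> U n" for n
    using U(1)[of n] by (auto simp: p_def)
  have q: "T closure_of U (Suc n) \<subseteq> U n" "\<And>v. v \<in> U (Suc n) \<Longrightarrow> inv v \<in> U n"
    "\<And>v w. v \<in> U (Suc n) \<Longrightarrow> w \<in> U (Suc n) \<Longrightarrow> v \<otimes> w \<in> U n" for n
    using U(2)[of n] by (auto simp: q_def)
  define P where "P = (\<Inter>n. U n)"
  have PG: "P \<subseteq> carrier G" using p(1) openin_subset_carrier unfolding P_def by blast
  have "P \<noteq> {}" using p(2) unfolding P_def by blast
  then have "subgroup P G"
    using PG p q by (intro subgroupI) (auto simp: P_def)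
  then have "P \<lhd> G" unfolding normal_inv_iff using p by (auto simp: P_def)
  moreover have "closedin T P"
  proof -
    have "U n \<subseteq> T closure_of U n" for n using p(1) closure_of_subset openin_subset by metis
    then have "P = (\<Inter>n. T closure_of U n)" using q(1) unfolding P_def by blast
    moreover have "closedin T (\<Inter>n. T closure_of U n)" by (intro closedin_INT) auto
    ultimately show ?thesis by simp
  qed
  moreover have "continuum_intersection P"
  proof -
    have "P = (\<Inter>n\<in>range (\<lambda>r::real. nat \<lfloor>r\<rfloor>). U n)" using surj_real_nat by (simp add: P_def)
    then have "P = (\<Inter>r::real. U (nat \<lfloor>r\<rfloor>))" by auto
    then show ?thesis unfolding continuum_intersection_def
      by (intro exI[of _ "\<lambda>r. U (nat \<lfloor>r\<rfloor>)"]) (simp add: p(1))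
  qed
  moreover have "m \<notin> P" using p(3) by (auto simp: P_def)
  ultimately show thesis using that unfolding closed_normal_def by blast
qed

text \<open>Density modulo \<open>M\<close>, with continuum many witnesses. The multiplicity is what makes it possible
  to refine the family inside its cosets, see \<open>refine_dense_family\<close>.\<close>

definition dense_family :: "'a set \<Rightarrow> (real \<Rightarrow> 'a) \<Rightarrow> bool" where
  "dense_family M x \<longleftrightarrow> (\<forall>U g. openin T U \<and> g \<in> carrier G \<and> g <# M \<subseteq> U \<longrightarrow>
     |UNIV :: real set| \<le>o |{j. x j <# M \<subseteq> U}| )"

text \<open>For a nonempty basic open set B of the base modulo Q, the set B M is an open union of
  cosets of M, so c many cosets y_j M meet B. Hence every pair of a basic set and a real can be
  given an index j of its own, and z_j is chosen in y_j M inside the basic set of that pair. All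
  other cosets keep their representative.\<close>

lemma refine_dense_family:
  assumes T: "compact_space T" and Q: "closed_normal Q" "continuum_intersection Q"
    and M: "closed_normal M" and y: "\<And>j. y j \<in> carrier G" "dense_family M y"
  obtains z where "\<And>j. z j \<in> y j <# M" "dense_family Q z"
proof -
  note M' = closed_normal_subgroup[OF M]
  obtain \<B> where \<B>: "|\<B>| \<le>o |UNIV :: real set|" "\<And>B. B \<in> \<B> \<Longrightarrow> openin T B"
    "\<And>g U. g \<in> carrier G \<Longrightarrow> openin T U \<Longrightarrow> g <# Q \<subseteq> U \<Longrightarrow> \<exists>B\<in>\<B>. g \<in> B \<and> B <#> Q \<subseteq> U"
    using continuum_base_translates[OF T Q] by metis
  have QG: "\<one> <# Q \<subseteq> carrier G" using closed_normal_subgroup[OF Q(1)] by (auto simp: l_coset_def)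
  define \<C> where "\<C> = \<B> - {{}}"
  have "\<C> \<noteq> {}" using \<B>(3)[OF one_closed _ QG] openin_topspace[of T] topspace_eq
    unfolding \<C>_def by fastforce
  moreover have "|\<C>| \<le>o |UNIV :: real set|"
    unfolding \<C>_def using \<B>(1) card_of_mono1[of "\<B> - {{}}" \<B>] ordLeq_transitive by blast
  ultimately obtain b where b: "b ` (UNIV :: real set) = \<C>" using card_of_ordLeq2 by metis
  obtain p :: "real \<Rightarrow> real \<times> real" where p: "surj p" using surj_real_pair by blast
  define A where "A r = {j. (y j <# M) \<inter> b (fst (p r)) \<noteq> {}}" for r
  have "|UNIV :: real set| \<le>o |A r|" for r
  proof -
    let ?B = "b (fst (p r))"
    have "?B \<in> \<C>" using b by blast
    then obtain g where g: "g \<in> ?B" and B: "openin T ?B" using \<B>(2) unfolding \<C>_def by blast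
    have BG: "?B \<subseteq> carrier G" using B openin_subset_carrier by blast
    have "openin T (?B <#> M)" using B M' openin_set_mult_right by blast
    moreover have "g <# M \<subseteq> ?B <#> M" using g by (auto simp: l_coset_def set_mult_def)
    ultimately have "|UNIV :: real set| \<le>o |{j. y j <# M \<subseteq> ?B <#> M}|"
      using y(2) g BG unfolding dense_family_def by blast
    moreover have "{j. y j <# M \<subseteq> ?B <#> M} \<subseteq> A r"
    proof clarify
      fix j assume "y j <# M \<subseteq> ?B <#> M"
      then have "y j \<in> ?B <#> M" using mem_l_coset_self[OF M'(3) y(1)] by blast
      then obtain c m where cm: "c \<in> ?B" "m \<in> M" "y j = c \<otimes> m" by (auto simp: set_mult_def)
      then have "c \<in> carrier G" "m \<in> carrier G" using BG M' by auto
      then have "c = y j \<otimes> inv m" using cm by (simp add: m_assoc)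
      moreover have "inv m \<in> M" using cm M'(1) by (simp add: subgroup.m_inv_closed)
      ultimately have "c \<in> y j <# M" by (auto simp: l_coset_def)
      then show "j \<in> A r" using cm unfolding A_def by blast
    qed
    ultimately show ?thesis using card_of_mono1 ordLeq_transitive by blast
  qed
  then obtain f where f: "inj f" "\<And>r. f r \<in> A r" using inj_choice_of_large_sets by blast
  have "\<exists>v. v \<in> y j <# M \<and> (\<forall>r. j = f r \<longrightarrow> v \<in> b (fst (p r)))" for j
  proof (cases "j \<in> range f")
    case True
    then obtain r where r: "j = f r" by blast
    then obtain v where "v \<in> y j <# M" "v \<in> b (fst (p r))" using f(2)[of r] unfolding A_def by blast
    then show ?thesis using r f(1) by (metis injD)
  next
    case False
    then show ?thesis using mem_l_coset_self[OF M'(3) y(1)] by blast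
  qed
  then obtain z where z: "\<And>j. z j \<in> y j <# M" "\<And>r. z (f r) \<in> b (fst (p r))" by metis
  have "dense_family Q z"
    unfolding dense_family_def
  proof (intro allI impI, elim conjE)
    fix U g assume U: "openin T U" "g \<in> carrier G" "g <# Q \<subseteq> U"
    then obtain B where B: "B \<in> \<B>" "g \<in> B" "B <#> Q \<subseteq> U" using \<B>(3) by blast
    then have "B \<in> \<C>" unfolding \<C>_def by blast
    then obtain s where s: "B = b s" using b by blast
    \<comment> \<open>The second component of a pair is a free label: for the fixed basic set
      \<open>b s\<close>, letting the label run through the reals yields the c many
      witnesses.\<close>
    define k where "k t = inv_into UNIV p (s, t)" for t
    have k: "p (k t) = (s, t)" for t using p by (simp add: k_def surj_f_inv_f)
    have "inj (\<lambda>t. f (k t))"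
    proof (rule injI)
      fix t t' assume "f (k t) = f (k t')"
      then have "p (k t) = p (k t')" using f(1) by (simp add: inj_eq)
      then show "t = t'" using k by simp
    qed
    moreover have "range (\<lambda>t. f (k t)) \<subseteq> {j. z j <# Q \<subseteq> U}"
    proof clarify
      fix t x assume x: "x \<in> z (f (k t)) <# Q"
      have "z (f (k t)) \<in> B" using z(2)[of "k t"] k s by simp
      then have "x \<in> B <#> Q" using x by (auto simp: l_coset_def set_mult_def)
      then show "x \<in> U" using B by blast
    qed
    ultimately show "|UNIV :: real set| \<le>o |{j. z j <# Q \<subseteq> U}|"
      using card_of_ordLeq by blast
  qed
  then show thesis using that z by blast
qed

end

lemma finite_chain_has_top:
  assumes "finite F" "F \<noteq> {}" and "\<And>k. R k k" and "\<And>k l m. R k l \<Longrightarrow> R l m \<Longrightarrow> R k m"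
    and "\<And>k l. k \<in> F \<Longrightarrow> l \<in> F \<Longrightarrow> R k l \<or> R l k"
  shows "\<exists>l\<in>F. \<forall>k\<in>F. R k l"
  using assms(1,2,5)
proof (induction F rule: finite_ne_induct)
  case (singleton a)
  then show ?case using assms(3) by simp
next
  case (insert a F)
  then obtain l where l: "l \<in> F" "\<forall>k\<in>F. R k l" by blast
  have "R a l \<or> R l a" using insert l by blast
  then show ?case
  proof
    assume "R a l"
    then show ?thesis using l by blast
  next
    assume "R l a"
    then have "\<forall>k\<in>insert a F. R k a" using l assms(3,4) by blast
    then show ?thesis by blast
  qed
qed

context topological_group
begin

text \<open>The order along the chain. Cosets with equal index are compared, not representatives,
  because the representatives change from stage to stage.\<close>

definition finer :: "'a set \<Rightarrow> (real \<Rightarrow> 'a) \<Rightarrow> 'a set \<Rightarrow> (real \<Rightarrow> 'a) \<Rightarrow> bool" where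
  "finer N z M x \<longleftrightarrow> N \<subseteq> M \<and> (\<forall>j. z j <# N \<subseteq> x j <# M)"

text \<open>The y_j exist by the finite intersection property of nested cosets. If U contains g N,
  where N is the intersection, compactness and the chain condition give one l with g M_l inside U
  (or else U is everything); the witnesses for M_l remain witnesses, since y_j and x_{l,j} lie in
  the same coset of M_l. The case of an empty A starts the chain.\<close>

lemma dense_family_limit:
  assumes T: "compact_space T"
    and M: "\<And>k. k \<in> A \<Longrightarrow> closed_normal (M k)"
    and x: "\<And>k j. k \<in> A \<Longrightarrow> x k j \<in> carrier G" "\<And>k. k \<in> A \<Longrightarrow> dense_family (M k) (x k)"
    and chain: "\<And>k l. k \<in> A \<Longrightarrow> l \<in> A \<Longrightarrow> finer (M k) (x k) (M l) (x l) \<or> finer (M l) (x l) (M k) (x k)"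
  obtains y where "\<And>j. y j \<in> carrier G" "\<And>k j. k \<in> A \<Longrightarrow> y j \<in> x k j <# M k"
    "dense_family (carrier G \<inter> (\<Inter>k\<in>A. M k)) y"
proof -
  let ?N = "carrier G \<inter> (\<Inter>k\<in>A. M k)"
  note M' = closed_normal_subgroup[OF M]
  have top: "\<exists>l\<in>F. \<forall>k\<in>F. finer (M l) (x l) (M k) (x k)" if "finite F" "F \<noteq> {}" "F \<subseteq> A" for F
    using that(1,2)
  proof (rule finite_chain_has_top)
    fix k l m assume "finer (M l) (x l) (M k) (x k)" "finer (M m) (x m) (M l) (x l)"
    then show "finer (M m) (x m) (M k) (x k)" unfolding finer_def by blast
  next
    fix k l assume "k \<in> F" "l \<in> F"
    then show "finer (M l) (x l) (M k) (x k) \<or> finer (M k) (x k) (M l) (x l)" using chain that(3) by blast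
  qed (simp add: finer_def)
  have "\<exists>v. v \<in> carrier G \<and> (\<forall>k\<in>A. v \<in> x k j <# M k)" for j
  proof (rule ccontr)
    assume "\<not> ?thesis"
    then have "topspace T \<inter> (\<Inter>k\<in>A. x k j <# M k) \<subseteq> {}" unfolding topspace_eq by blast
    then obtain F where F: "finite F" "F \<subseteq> A" "topspace T \<inter> (\<Inter>k\<in>F. x k j <# M k) \<subseteq> {}"
      using compact_INT_subset[OF T, of A "\<lambda>k. x k j <# M k" "{}"] M'(4) x(1) closedin_l_coset by auto
    have ne: "F \<noteq> {}" using F(3) topspace_eq one_closed by auto
    obtain l where l: "l \<in> F" "\<And>k. k \<in> F \<Longrightarrow> finer (M l) (x l) (M k) (x k)" using top[OF F(1) ne F(2)] by blast
    have lA: "l \<in> A" using l F by blast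
    have "x l j \<in> x l j <# M l" using mem_l_coset_self[OF M'(3) x(1)] lA by blast
    then have "x l j \<in> topspace T \<inter> (\<Inter>k\<in>F. x k j <# M k)"
      using l x(1)[OF lA] unfolding topspace_eq finer_def by blast
    then show False using F by blast
  qed
  then obtain y where y: "\<And>j. y j \<in> carrier G" "\<And>k j. k \<in> A \<Longrightarrow> y j \<in> x k j <# M k" by metis
  have "dense_family ?N y"
    unfolding dense_family_def
  proof (intro allI impI, elim conjE)
    fix U g assume U: "openin T U" "g \<in> carrier G" "g <# ?N \<subseteq> U"
    have "topspace T \<inter> (\<Inter>k\<in>A. g <# M k) \<subseteq> U"
    proof
      fix v assume v: "v \<in> topspace T \<inter> (\<Inter>k\<in>A. g <# M k)"
      then have "inv g \<otimes> v \<in> ?N" using l_coset_eq_vimage[OF M'(2) U(2)] U(2) by (auto simp: topspace_eq)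
      then have "v \<in> g <# ?N" using v U(2) by (subst l_coset_eq_vimage) (auto simp: topspace_eq)
      then show "v \<in> U" using U by blast
    qed
    then obtain F where F: "finite F" "F \<subseteq> A" "topspace T \<inter> (\<Inter>k\<in>F. g <# M k) \<subseteq> U"
      using compact_INT_subset[OF T, of A "\<lambda>k. g <# M k" U] U M'(4) closedin_l_coset by auto
    show "|UNIV :: real set| \<le>o |{j. y j <# ?N \<subseteq> U}|"
    proof (cases "F = {}")
      case True
      then have "carrier G \<subseteq> U" using F(3) topspace_eq by simp
      moreover have "y j <# ?N \<subseteq> carrier G" for j using y(1) by (auto simp: l_coset_def)
      ultimately have "{j. y j <# ?N \<subseteq> U} = UNIV" by blast
      then show ?thesis by (simp add: card_of_mono1)
    next
      case False
      obtain l where l: "l \<in> F" "\<And>k. k \<in> F \<Longrightarrow> finer (M l) (x l) (M k) (x k)" using top[OF F(1) False F(2)] by blast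
      have lA: "l \<in> A" using l F by blast
      have "g <# M l \<subseteq> U"
      proof
        fix v assume v: "v \<in> g <# M l"
        then have "v \<in> g <# M k" if "k \<in> F" for k using l(2)[OF that] unfolding finer_def l_coset_def by blast
        moreover have "v \<in> topspace T" using v l_coset_eq_vimage[OF M'(2)[OF lA] U(2)] topspace_eq by auto
        ultimately show "v \<in> U" using F(3) by blast
      qed
      then have "|UNIV :: real set| \<le>o |{j. x l j <# M l \<subseteq> U}|"
        using x(2)[OF lA] U unfolding dense_family_def by blast
      moreover have "{j. x l j <# M l \<subseteq> U} \<subseteq> {j. y j <# ?N \<subseteq> U}"
      proof clarify
        fix j v assume sub: "x l j <# M l \<subseteq> U" and "v \<in> y j <# ?N"
        then have "v \<in> y j <# M l" using lA by (auto simp: l_coset_def)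
        moreover have "x l j <# M l = y j <# M l"
          using l_repr_independence[OF y(2)[OF lA] x(1)[OF lA] M'(1)[OF lA]] .
        ultimately show "v \<in> U" using sub by blast
      qed
      ultimately show ?thesis using card_of_mono1 ordLeq_transitive by blast
    qed
  qed
  then show thesis using that y by blast
qed

text \<open>The cosets \<open>z j M\<close> shrink along a chain whose length is the successor of the continuum. Each
  initial segment of the chain has an intersection of weight at most the continuum, hence
  distinct from \<open>{1}\<close>, so that the chain can go on strictly; the whole chain is too long for its
  intersection to be of that weight.\<close>

theorem exists_dense_family:
  assumes T: "compact_space T" and w: "\<not> weight T \<le>o |UNIV :: real set|"
  obtains N y where "closed_normal N" "\<not> continuum_intersection N"
    "\<And>j. y j \<in> carrier G" "dense_family N y"
proof -
  define \<rho> where "\<rho> = cardSuc |UNIV :: real set|"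
  have cr: "Card_order |UNIV :: real set|" by (rule card_of_Card_order)
  have co: "Card_order \<rho>" unfolding \<rho>_def using cr by (rule cardSuc_Card_order)
  then have wo: "Well_order \<rho>" using card_order_on_well_order_on by blast
  have lin: "Total \<rho>" "trans \<rho>" "antisym \<rho>"
    using wo by (simp_all add: well_order_on_def linear_order_on_def partial_order_on_def preorder_on_def)
  have inf: "infinite (Field \<rho>)"
    unfolding \<rho>_def using cardSuc_finite[OF cr] infinite_UNIV_char_0 by (simp add: Field_card_of)
  have wf: "wf (\<rho> - Id)" using wo well_order_on_def by blast
  have small: "|underS \<rho> i| \<le>o |UNIV :: real set|" if "i \<in> Field \<rho>" for i
  proof -
    have "|underS \<rho> i| <o \<rho>" using card_of_underS[OF co that] .
    then show ?thesis unfolding \<rho>_def using cardSuc_ordLeq_ordLess[OF cr card_of_Card_order] by blast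
  qed
  \<comment> \<open>The last clause makes the chain strict: stage i omits a point common to all
    earlier stages. The recursion runs over the whole type \<open>real set\<close>; an index outside
    \<open>Field \<rho>\<close> has no predecessors, so its value is just another possible first
    stage.\<close>
  define p where "p f i v \<longleftrightarrow> closed_normal (fst v) \<and> continuum_intersection (fst v) \<and>
    (\<forall>j. snd v j \<in> carrier G) \<and> dense_family (fst v) (snd v) \<and>
    (\<forall>k\<in>underS \<rho> i. finer (fst v) (snd v) (fst (f k)) (snd (f k))) \<and>
    \<not> carrier G \<inter> (\<Inter>k\<in>underS \<rho> i. fst (f k)) \<subseteq> fst v"
    for f :: "real set \<Rightarrow> 'a set \<times> (real \<Rightarrow> 'a)" and i v
  have uS: "k \<in> underS \<rho> i \<longleftrightarrow> (k, i) \<in> \<rho> - Id" for k i by (auto simp: underS_def)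
  have comparable: "finer (fst (f k)) (snd (f k)) (fst (f l)) (snd (f l)) \<or> finer (fst (f l)) (snd (f l)) (fst (f k)) (snd (f k))"
    if "p f k (f k)" "p f l (f l)" "k \<in> Field \<rho>" "l \<in> Field \<rho>" for f k l
  proof (cases "k = l")
    case False
    then have "k \<in> underS \<rho> l \<or> l \<in> underS \<rho> k"
      using lin(1) that(3,4) unfolding total_on_def uS by blast
    then show ?thesis using that unfolding p_def by blast
  qed (simp add: finer_def)
  have "\<exists>f. \<forall>i. p f i (f i)"
    using wf
  proof (rule dependent_wf_choice)
    fix f g i v assume "\<And>z. (z, i) \<in> \<rho> - Id \<Longrightarrow> f z = (g z :: 'a set \<times> (real \<Rightarrow> 'a))"
    then have "f z = g z" if "z \<in> underS \<rho> i" for z using that uS by blast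
    then show "p f i v = p g i v" by (simp add: p_def)
  next
    fix i f assume f: "\<And>k. (k, i) \<in> \<rho> - Id \<Longrightarrow> p f k (f k)"
    let ?A = "underS \<rho> i"
    have pf: "p f k (f k)" if "k \<in> ?A" for k using f that uS by blast
    have AF: "?A \<subseteq> Field \<rho>" by (auto simp: underS_def Field_def)
    define N where "N = carrier G \<inter> (\<Inter>k\<in>?A. fst (f k))"
    have cn: "closed_normal N"
      unfolding N_def using pf by (intro closed_normal_INT) (auto simp: p_def)
    obtain y where y: "\<And>j. y j \<in> carrier G" "\<And>k j. k \<in> ?A \<Longrightarrow> y j \<in> snd (f k) j <# fst (f k)"
      "dense_family N y"
    proof (rule dense_family_limit[OF T, of ?A "\<lambda>k. fst (f k)" "\<lambda>k. snd (f k)"])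
      fix k l assume "k \<in> ?A" "l \<in> ?A"
      then show "finer (fst (f k)) (snd (f k)) (fst (f l)) (snd (f l)) \<or> finer (fst (f l)) (snd (f l)) (fst (f k)) (snd (f k))"
        using comparable pf AF by blast
    qed (use pf in \<open>auto simp: p_def N_def\<close>)
    have gc: "continuum_intersection N"
    proof (cases "?A = {}")
      case True
      then show ?thesis using continuum_intersection_carrier by (simp add: N_def)
    next
      case False
      then have "i \<in> Field \<rho>" by (auto simp: underS_def Field_def)
      then have "continuum_intersection (\<Inter>k\<in>?A. fst (f k))"
        using False small pf by (intro continuum_intersection_INT) (auto simp: p_def)
      then show ?thesis unfolding N_def using continuum_intersection_Int continuum_intersection_carrier by blast
    qed
    have "N \<noteq> {\<one>}" using weight_le_of_continuum_intersection_one[OF T] w gc by blast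
    then obtain m where m: "m \<in> N" "m \<noteq> \<one>" using closed_normal_subgroup(3)[OF cn] by blast
    then have "m \<in> carrier G" by (simp add: N_def)
    then obtain P where P: "closed_normal P" "continuum_intersection P" "m \<notin> P"
      using small_closed_normal_avoiding[OF T _ m(2)] by blast
    have Q: "closed_normal (N \<inter> P)" "continuum_intersection (N \<inter> P)"
      using closed_normal_Int[OF cn P(1)] continuum_intersection_Int[OF gc P(2)] by auto
    obtain z where z: "\<And>j. z j \<in> y j <# N" "dense_family (N \<inter> P) z"
      using refine_dense_family[OF T Q cn y(1,3)] by blast
    have NG: "N \<subseteq> carrier G" by (simp add: N_def)
    have "p f i (N \<inter> P, z)"
      unfolding p_def fst_conv snd_conv
    proof (intro conjI allI ballI Q z(2))
      show "z j \<in> carrier G" for j using z(1)[of j] y(1) NG by (auto simp: l_coset_def)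
      show "\<not> carrier G \<inter> (\<Inter>k\<in>?A. fst (f k)) \<subseteq> N \<inter> P" using m P(3) unfolding N_def by blast
    next
      fix k assume k: "k \<in> ?A"
      have fk: "closed_normal (fst (f k))" "snd (f k) j \<in> carrier G" for j using pf[OF k] by (auto simp: p_def)
      have Nk: "N \<subseteq> fst (f k)" using k by (auto simp: N_def)
      have "z j <# (N \<inter> P) \<subseteq> snd (f k) j <# fst (f k)" for j
      proof -
        have "snd (f k) j <# fst (f k) = y j <# fst (f k)"
          using l_repr_independence[OF y(2)[OF k] fk(2) closed_normal_subgroup(1)[OF fk(1)]] .
        moreover have "z j \<in> y j <# fst (f k)" using z(1)[of j] Nk by (auto simp: l_coset_def)
        then have "y j <# fst (f k) = z j <# fst (f k)"
          using l_repr_independence y(1) closed_normal_subgroup(1)[OF fk(1)] by metis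
        ultimately show ?thesis using Nk by (auto simp: l_coset_def)
      qed
      then show "finer (N \<inter> P) z (fst (f k)) (snd (f k))" using Nk unfolding finer_def by blast
    qed
    then show "\<exists>v. p f i v" by blast
  qed
  then obtain f where f: "\<And>i. p f i (f i)" by blast
  let ?F = "Field \<rho>"
  define N where "N = carrier G \<inter> (\<Inter>k\<in>?F. fst (f k))"
  have cn: "closed_normal N" unfolding N_def using f by (intro closed_normal_INT) (auto simp: p_def)
  obtain y where y: "\<And>j. y j \<in> carrier G" "dense_family N y"
  proof (rule dense_family_limit[OF T, of ?F "\<lambda>k. fst (f k)" "\<lambda>k. snd (f k)"])
    fix k l assume "k \<in> ?F" "l \<in> ?F"
    then show "finer (fst (f k)) (snd (f k)) (fst (f l)) (snd (f l)) \<or> finer (fst (f l)) (snd (f l)) (fst (f k)) (snd (f k))"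
      using comparable f by blast
  qed (use f in \<open>auto simp: p_def N_def\<close>)
  have "\<not> continuum_intersection N"
  proof
    assume "continuum_intersection N"
    then obtain U where U: "\<And>r::real. openin T (U r)" "N = (\<Inter>r. U r)"
      unfolding continuum_intersection_def by blast
    have "\<exists>k\<in>?F. fst (f k) \<subseteq> U r" for r
    proof -
      have sub: "topspace T \<inter> (\<Inter>k\<in>?F. fst (f k)) \<subseteq> U r" using U(2) unfolding N_def topspace_eq by blast
      have cl: "closedin T (fst (f k))" for k using f[of k] unfolding p_def closed_normal_def by blast
      obtain F where F: "finite F" "F \<subseteq> ?F" "topspace T \<inter> (\<Inter>k\<in>F. fst (f k)) \<subseteq> U r"
        by (rule compact_INT_subset[OF T cl U(1) sub])
      have fG: "fst (f k) \<subseteq> carrier G" for k using f[of k] closed_normal_subgroup(2) unfolding p_def by blast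
      show ?thesis
      proof (cases "F = {}")
        case True
        obtain k where "k \<in> ?F" using inf by fastforce
        then show ?thesis using F(3) fG True unfolding topspace_eq by auto
      next
        case False
        have "\<exists>l\<in>F. \<forall>k\<in>F. finer (fst (f l)) (snd (f l)) (fst (f k)) (snd (f k))"
          using F(1) False
        proof (rule finite_chain_has_top)
          fix k l m assume "finer (fst (f l)) (snd (f l)) (fst (f k)) (snd (f k))"
            "finer (fst (f m)) (snd (f m)) (fst (f l)) (snd (f l))"
          then show "finer (fst (f m)) (snd (f m)) (fst (f k)) (snd (f k))" unfolding finer_def by blast
        next
          fix k l assume "k \<in> F" "l \<in> F"
          then show "finer (fst (f l)) (snd (f l)) (fst (f k)) (snd (f k)) \<or> finer (fst (f k)) (snd (f k)) (fst (f l)) (snd (f l))"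
            using comparable[OF f f] F(2) by blast
        qed (simp add: finer_def)
        then obtain l where l: "l \<in> F" "\<And>k. k \<in> F \<Longrightarrow> fst (f l) \<subseteq> fst (f k)" unfolding finer_def by blast
        then have "fst (f l) \<subseteq> topspace T \<inter> (\<Inter>k\<in>F. fst (f k))" using fG unfolding topspace_eq by blast
        then have "fst (f l) \<subseteq> U r" using F(3) by (rule subset_trans)
        then show ?thesis using l(1) F(2) by blast
      qed
    qed
    then obtain k where k: "\<And>r. k r \<in> ?F" "\<And>r. fst (f (k r)) \<subseteq> U r" by metis
    \<comment> \<open>Successor cardinals are regular, so the c many indices \<open>k r\<close> lie
      below a single i. \<open>cardSuc_UNION\<close> expresses this by the increasing union of the
      initial segments.\<close>
    have rel: "relChain \<rho> (underS \<rho>)"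
      unfolding relChain_def
    proof (intro allI impI subsetI)
      fix i l a assume "(i, l) \<in> \<rho>" "a \<in> underS \<rho> i"
      then show "a \<in> underS \<rho> l" using lin(2,3) unfolding underS_def trans_def antisym_def by blast
    qed
    have "range k \<subseteq> (\<Union>i\<in>?F. underS \<rho> i)"
    proof
      fix a assume "a \<in> range k"
      then have "a \<in> ?F" using k(1) by blast
      then obtain b where "b \<in> ?F" "a \<noteq> b" "(a, b) \<in> \<rho>" using infinite_Card_order_limit[OF co inf] by blast
      then show "a \<in> (\<Union>i\<in>?F. underS \<rho> i)" by (auto simp: underS_def)
    qed
    then obtain i where i: "i \<in> ?F" "range k \<subseteq> underS \<rho> i"
      using cardSuc_UNION[OF cr _ rel[unfolded \<rho>_def], of "range k"] card_of_image[of k UNIV] infinite_UNIV_char_0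
      unfolding \<rho>_def by (auto simp: Field_card_of)
    \<comment> \<open>The intersection of the stages before i would lie in N and hence in stage i,
      which strictness forbids.\<close>
    have "\<not> carrier G \<inter> (\<Inter>k\<in>underS \<rho> i. fst (f k)) \<subseteq> fst (f i)" using f[of i] unfolding p_def by blast
    moreover have "carrier G \<inter> (\<Inter>k\<in>underS \<rho> i. fst (f k)) \<subseteq> (\<Inter>r. U r)" using i(2) k(2) by blast
    ultimately show False using i(1) unfolding U(2)[symmetric] N_def by blast
  qed
  then show thesis using that cn y by blast
qed

end

section \<open>Quotient groups\<close>

definition quotient_topology :: "'a topology \<Rightarrow> ('a \<Rightarrow> 'b) \<Rightarrow> 'b topology" where
  "quotient_topology X q = topology (\<lambda>U. U \<subseteq> q ` topspace X \<and> openin X {x \<in> topspace X. q x \<in> U})"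

lemma openin_quotient_topology:
  "openin (quotient_topology X q) U \<longleftrightarrow> U \<subseteq> q ` topspace X \<and> openin X {x \<in> topspace X. q x \<in> U}"
proof -
  have "istopology (\<lambda>U. U \<subseteq> q ` topspace X \<and> openin X {x \<in> topspace X. q x \<in> U})"
    unfolding istopology_def
  proof (intro conjI allI impI)
    fix S T
    assume "S \<subseteq> q ` topspace X \<and> openin X {x \<in> topspace X. q x \<in> S}"
      "T \<subseteq> q ` topspace X \<and> openin X {x \<in> topspace X. q x \<in> T}"
    moreover have "{x \<in> topspace X. q x \<in> S \<inter> T} = {x \<in> topspace X. q x \<in> S} \<inter> {x \<in> topspace X. q x \<in> T}"
      by blast
    ultimately show "S \<inter> T \<subseteq> q ` topspace X" "openin X {x \<in> topspace X. q x \<in> S \<inter> T}" by auto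
  next
    fix \<U> assume "\<forall>U\<in>\<U>. U \<subseteq> q ` topspace X \<and> openin X {x \<in> topspace X. q x \<in> U}"
    moreover have "{x \<in> topspace X. q x \<in> \<Union>\<U>} = (\<Union>U\<in>\<U>. {x \<in> topspace X. q x \<in> U})" by blast
    ultimately show "\<Union>\<U> \<subseteq> q ` topspace X" "openin X {x \<in> topspace X. q x \<in> \<Union>\<U>}" by auto
  qed
  then show ?thesis unfolding quotient_topology_def by (simp add: topology_inverse')
qed

lemma topspace_quotient_topology: "topspace (quotient_topology X q) = q ` topspace X"
proof
  show "topspace (quotient_topology X q) \<subseteq> q ` topspace X"
    using openin_topspace[of "quotient_topology X q"] unfolding openin_quotient_topology by (rule conjunct1)
  have "openin (quotient_topology X q) (q ` topspace X)"
    unfolding openin_quotient_topology by (auto intro: openin_subopen[THEN iffD2])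
  then show "q ` topspace X \<subseteq> topspace (quotient_topology X q)" by (rule openin_subset)
qed

lemma continuous_map_quotient_topology: "continuous_map X (quotient_topology X q) q"
  by (auto simp: continuous_map_def topspace_quotient_topology openin_quotient_topology)

context topological_group
begin

context
  fixes N :: "'a set"
  assumes N: "closed_normal N"
begin

lemma r_coset_eq_iff:
  assumes "x \<in> carrier G" "y \<in> carrier G"
  shows "N #> x = N #> y \<longleftrightarrow> x \<otimes> inv y \<in> N"
proof -
  note N' = closed_normal_subgroup[OF N]
  have "N #> x = N #> y \<longleftrightarrow> x \<in> N #> y"
    using repr_independence[OF _ assms(2) N'(1)] rcos_self[OF assms(1) N'(1)] by blast
  then show ?thesis using subgroup.rcos_module[OF N'(1) is_group assms(2,1)] by simp
qed

text \<open>The saturation of U is the product N U, a union of translates of U.\<close>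

lemma openin_quotient_image:
  assumes U: "openin T U"
  shows "openin (quotient_topology T (\<lambda>x. N #> x)) ((\<lambda>x. N #> x) ` U)"
proof -
  note N' = closed_normal_subgroup[OF N]
  have UG: "U \<subseteq> carrier G" using U openin_subset_carrier by blast
  have "{x \<in> topspace T. N #> x \<in> (\<lambda>x. N #> x) ` U} = (\<Union>n\<in>N. n <# U)"
  proof (intro equalityI subsetI)
    fix x assume "x \<in> {x \<in> topspace T. N #> x \<in> (\<lambda>x. N #> x) ` U}"
    then obtain u where u: "x \<in> carrier G" "u \<in> U" "N #> x = N #> u" by (auto simp: topspace_eq)
    then have "x \<otimes> inv u \<in> N" using r_coset_eq_iff UG by blast
    moreover have "x = (x \<otimes> inv u) \<otimes> u" using u UG by (simp add: m_assoc subset_iff)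
    ultimately show "x \<in> (\<Union>n\<in>N. n <# U)" using u unfolding l_coset_def by blast
  next
    fix x assume "x \<in> (\<Union>n\<in>N. n <# U)"
    then obtain n u where nu: "n \<in> N" "u \<in> U" "x = n \<otimes> u" by (auto simp: l_coset_def)
    then have c: "n \<in> carrier G" "u \<in> carrier G" using UG N' by auto
    then have "x \<otimes> inv u = n" using nu by (simp add: m_assoc)
    then have "N #> x = N #> u" using r_coset_eq_iff[of x u] c nu by simp
    then show "x \<in> {x \<in> topspace T. N #> x \<in> (\<lambda>x. N #> x) ` U}" using nu c by (simp add: topspace_eq)
  qed
  moreover have "openin T (\<Union>n\<in>N. n <# U)" using U N' openin_l_coset by blast
  ultimately show ?thesis using UG unfolding openin_quotient_topology by (auto simp: topspace_eq)
qed

text \<open>A product of two quotient maps need not be a quotient map; continuity of the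
  multiplication rests on the openness of the projection. The Hausdorff property comes from N being
  closed.\<close>

lemma topological_group_Mod: "topological_group (G Mod N) (quotient_topology T (\<lambda>x. N #> x))"
proof -
  let ?q = "\<lambda>x. N #> x" and ?S = "quotient_topology T (\<lambda>x. N #> x)"
  have Nn: "N \<lhd> G" using N by (simp add: closed_normal_def)
  interpret Q: group "G Mod N" by (rule normal.factorgroup_is_group[OF Nn])
  interpret gh: group_hom G "G Mod N" ?q
    using normal.r_coset_hom_Mod[OF Nn] by unfold_locales
  have top: "topspace ?S = ?q ` carrier G" by (simp add: topspace_quotient_topology topspace_eq)
  have mult: "?q x <#> ?q y = ?q (x \<otimes> y)" if "x \<in> carrier G" "y \<in> carrier G" for x y
    using normal.rcos_sum[OF Nn that] .
  show ?thesis
  proof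
    show "topspace ?S = carrier (G Mod N)" unfolding top carrier_FactGroup ..
    show "continuous_map (prod_topology ?S ?S) ?S (\<lambda>(x, y). x \<otimes>\<^bsub>G Mod N\<^esub> y)"
      unfolding continuous_map_def
    proof (intro conjI allI impI)
      show "(\<lambda>(x, y). x \<otimes>\<^bsub>G Mod N\<^esub> y) \<in> topspace (prod_topology ?S ?S) \<rightarrow> topspace ?S"
      proof
        fix p assume "p \<in> topspace (prod_topology ?S ?S)"
        then obtain x y where xy: "x \<in> carrier G" "y \<in> carrier G" "p = (?q x, ?q y)" by (auto simp: top)
        then have "?q (x \<otimes> y) \<in> topspace ?S" unfolding top by blast
        then show "(\<lambda>(x, y). x \<otimes>\<^bsub>G Mod N\<^esub> y) p \<in> topspace ?S"
          using mult[OF xy(1,2)] xy(3) by simp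
      qed
      fix W assume W: "openin ?S W"
      let ?P = "{p \<in> topspace (prod_topology ?S ?S). (case p of (x, y) \<Rightarrow> x \<otimes>\<^bsub>G Mod N\<^esub> y) \<in> W}"
      let ?W = "{x \<in> topspace T. ?q x \<in> W}"
      have oW: "openin T ?W" using W openin_quotient_topology by blast
      show "openin (prod_topology ?S ?S) ?P"
        unfolding openin_prod_topology_alt
      proof (intro allI impI)
        fix X Y assume XY: "(X, Y) \<in> ?P"
        then obtain x y where x: "x \<in> carrier G" "X = ?q x" and y: "y \<in> carrier G" "Y = ?q y"
          by (auto simp: top)
        have "?q x <#> ?q y \<in> W" using XY x y by simp
        then have "?q (x \<otimes> y) \<in> W" unfolding mult[OF x(1) y(1)] .
        then have xyW: "x \<otimes> y \<in> ?W" using x(1) y(1) by (simp add: topspace_eq)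
        obtain V1 V2 where V: "openin T V1" "openin T V2" "x \<in> V1" "y \<in> V2"
          "\<And>v w. v \<in> V1 \<Longrightarrow> w \<in> V2 \<Longrightarrow> v \<otimes> w \<in> ?W"
          using nbhd_mult[OF oW x(1) y(1) xyW] by blast
        have VG: "V1 \<subseteq> carrier G" "V2 \<subseteq> carrier G" using V openin_subset_carrier by auto
        have "?q ` V1 \<times> ?q ` V2 \<subseteq> ?P"
        proof
          fix p assume "p \<in> ?q ` V1 \<times> ?q ` V2"
          then obtain v w where vw: "v \<in> V1" "w \<in> V2" and p: "p = (?q v, ?q w)" by blast
          have vwG: "v \<in> carrier G" "w \<in> carrier G" using vw VG by auto
          have "?q (v \<otimes> w) \<in> W" using V(5)[OF vw] by blast
          then have "?q v <#> ?q w \<in> W" unfolding mult[OF vwG] .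
          then show "p \<in> ?P" unfolding p using vwG by (simp add: top)
        qed
        then show "\<exists>U V. openin ?S U \<and> openin ?S V \<and> X \<in> U \<and> Y \<in> V \<and> U \<times> V \<subseteq> ?P"
          using V(1-4) openin_quotient_image x y by blast
      qed
    qed
    show "continuous_map ?S ?S (\<lambda>x. inv\<^bsub>G Mod N\<^esub> x)"
      unfolding continuous_map_def
    proof (intro conjI allI impI)
      show "(\<lambda>x. inv\<^bsub>G Mod N\<^esub> x) \<in> topspace ?S \<rightarrow> topspace ?S"
        unfolding top carrier_FactGroup[symmetric] by simp
      fix W assume W: "openin ?S W"
      then have "openin T {x \<in> topspace T. ?q x \<in> W}" using openin_quotient_topology by blast
      then have "openin T {x \<in> topspace T. inv x \<in> {x \<in> topspace T. ?q x \<in> W}}"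
        by (rule openin_continuous_map_preimage[OF continuous_inv])
      moreover have "{x \<in> topspace T. inv x \<in> {x \<in> topspace T. ?q x \<in> W}}
          = {x \<in> topspace T. ?q x \<in> {X \<in> topspace ?S. inv\<^bsub>G Mod N\<^esub> X \<in> W}}"
        by (auto simp: topspace_eq top gh.hom_inv)
      ultimately show "openin ?S {X \<in> topspace ?S. inv\<^bsub>G Mod N\<^esub> X \<in> W}"
        unfolding openin_quotient_topology by (auto simp: top topspace_eq)
    qed
    show "Hausdorff_space ?S"
      unfolding Hausdorff_space_def
    proof (intro allI impI, elim conjE)
      fix X Y assume XY: "X \<in> topspace ?S" "Y \<in> topspace ?S" "X \<noteq> Y"
      then obtain x y where x: "x \<in> carrier G" "X = ?q x" and y: "y \<in> carrier G" "Y = ?q y"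
        by (auto simp: top)
      have "x \<otimes> inv y \<in> topspace T - N" using XY x y r_coset_eq_iff by (auto simp: topspace_eq)
      moreover have "openin T (topspace T - N)" using N by (auto simp: closed_normal_def)
      ultimately obtain V W where VW: "openin T V" "openin T W" "x \<in> V" "inv y \<in> W"
        "\<And>v w. v \<in> V \<Longrightarrow> w \<in> W \<Longrightarrow> v \<otimes> w \<in> topspace T - N"
        using nbhd_mult[of "topspace T - N" x "inv y"] x y by (metis inv_closed)
      let ?W = "{w \<in> topspace T. inv w \<in> W}"
      have oW: "openin T ?W" using openin_continuous_map_preimage[OF continuous_inv VW(2)] .
      have VG: "V \<subseteq> carrier G" using VW openin_subset_carrier by blast
      have "disjnt (?q ` V) (?q ` ?W)"
        unfolding disjnt_iff
      proof (intro allI notI, elim conjE)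
        fix Z assume "Z \<in> ?q ` V" "Z \<in> ?q ` ?W"
        then obtain v w where vw: "v \<in> V" "w \<in> carrier G" "inv w \<in> W" "?q v = ?q w" by (auto simp: topspace_eq)
        then have "v \<otimes> inv w \<in> N" using r_coset_eq_iff VG by blast
        then show False using VW(5)[OF vw(1,3)] by blast
      qed
      moreover have "y \<in> ?W" using VW y by (simp add: topspace_eq)
      ultimately show "\<exists>U V. openin ?S U \<and> openin ?S V \<and> X \<in> U \<and> Y \<in> V \<and> disjnt U V"
        using openin_quotient_image[OF VW(1)] openin_quotient_image[OF oW] x(2) y(2) VW(3) by blast
    qed
  qed
qed

lemma epi_Mod: "(\<lambda>x. N #> x) \<in> epi G (G Mod N)"
  using normal.r_coset_hom_Mod[of N G] N by (simp add: epi_def carrier_FactGroup closed_normal_def)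

end

end

text \<open>The closure of a set under operations of countable arity consists of the values of well-founded
  countably branching terms. Such a term is determined by its labels along finite paths, so that
  there are only continuum many.\<close>

datatype op_tree = Leaf real | Node nat "nat \<Rightarrow> op_tree"

text \<open>The label at the empty path tells the constructors apart: 0 for a leaf, and n + 1, which
  is never 0, for a node. The value of a leaf is therefore stored on the nonempty paths.\<close>

primrec encode :: "op_tree \<Rightarrow> nat list \<Rightarrow> real" where
  "encode (Leaf r) = (\<lambda>p. case p of [] \<Rightarrow> 0 | _ \<Rightarrow> r)"
| "encode (Node n f) = (\<lambda>p. case p of [] \<Rightarrow> real n + 1 | k # p' \<Rightarrow> encode (f k) p')"

lemma inj_encode: "inj encode"
proof (rule injI)
  show "encode t = encode u \<Longrightarrow> t = u" for t u
  proof (induction t arbitrary: u)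
    case (Leaf r)
    show ?case
    proof (cases u)
      case (Leaf r')
      then show ?thesis using fun_cong[OF Leaf.prems, of "[0]"] by simp
    next
      case (Node n f)
      then show ?thesis using fun_cong[OF Leaf.prems, of "[]"] by simp
    qed
  next
    case (Node n f)
    show ?case
    proof (cases u)
      case (Leaf r')
      then show ?thesis using fun_cong[OF Node.prems, of "[]"] by simp
    next
      case u: (Node n' f')
      have "encode (f k) = encode (f' k)" for k
      proof
        fix p show "encode (f k) p = encode (f' k) p"
          using fun_cong[OF Node.prems, of "k # p"] u by simp
      qed
      then have "f = f'" using Node.IH by (intro ext) blast
      moreover have "n = n'" using fun_cong[OF Node.prems, of "[]"] u by simp
      ultimately show ?thesis using u by simp
    qed
  qed
qed

primrec eval_tree :: "(nat \<Rightarrow> (nat \<Rightarrow> 'a) \<Rightarrow> 'a) \<Rightarrow> (real \<Rightarrow> 'a) \<Rightarrow> op_tree \<Rightarrow> 'a" where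
  "eval_tree op x (Leaf r) = x r"
| "eval_tree op x (Node n f) = op n (\<lambda>k. eval_tree op x (f k))"

lemma countable_operations_hull:
  fixes op :: "nat \<Rightarrow> (nat \<Rightarrow> 'a) \<Rightarrow> 'a" and x :: "real \<Rightarrow> 'a"
  assumes C: "range x \<subseteq> C" "\<And>n s. range s \<subseteq> C \<Longrightarrow> op n s \<in> C"
  obtains Y where "|Y| \<le>o |UNIV :: real set|" "range x \<subseteq> Y" "Y \<subseteq> C"
    "\<And>n s. range s \<subseteq> Y \<Longrightarrow> op n s \<in> Y"
proof (rule that[of "range (eval_tree op x)"])
  have "|range (eval_tree op x)| \<le>o |UNIV :: op_tree set|" by (rule card_of_image)
  also have "|UNIV :: op_tree set| \<le>o |UNIV :: (nat list \<Rightarrow> real) set|"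
    using inj_encode card_of_ordLeq by blast
  also have "|UNIV :: (nat list \<Rightarrow> real) set| \<le>o |UNIV :: real set|" by (rule card_of_countable_fun_real)
  finally show "|range (eval_tree op x)| \<le>o |UNIV :: real set|" .
  show "range x \<subseteq> range (eval_tree op x)"
    using eval_tree.simps(1)[of op x] by (metis image_subset_iff rangeI)
  have "eval_tree op x t \<in> C" for t
  proof (induction t)
    case (Leaf r)
    then show ?case using C(1) by auto
  next
    case (Node n f)
    then have "range (\<lambda>k. eval_tree op x (f k)) \<subseteq> C" by blast
    then show ?case using C(2) by simp
  qed
  then show "range (eval_tree op x) \<subseteq> C" by blast
  fix n and s :: "nat \<Rightarrow> 'a" assume "range s \<subseteq> range (eval_tree op x)"
  then have "\<forall>k. \<exists>t. s k = eval_tree op x t" by blast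
  then obtain f where "\<And>k. s k = eval_tree op x (f k)" by metis
  then have "s = (\<lambda>k. eval_tree op x (f k))" by blast
  then have "op n s = eval_tree op x (Node n f)" by simp
  then show "op n s \<in> range (eval_tree op x)" by (rule range_eqI)
qed

text \<open>Finitely many open sets, each catching only finitely many terms, cover C. The terms
  themselves may lie outside C, as happens when C is a coset of N at which the sequence merely
  accumulates.\<close>

lemma compactin_cluster_point:
  assumes C: "compactin X C" and no: "\<And>z. z \<in> C \<Longrightarrow> \<exists>U. openin X U \<and> z \<in> U \<and> finite {n. s n \<in> U}"
  obtains U where "openin X U" "C \<subseteq> U" "finite {n :: nat. s n \<in> U}"
proof -
  let ?\<U> = "{U. openin X U \<and> finite {n. s n \<in> U}}"
  have "C \<subseteq> \<Union>?\<U>" using no by blast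
  then obtain \<F> where \<F>: "finite \<F>" "\<F> \<subseteq> ?\<U>" "C \<subseteq> \<Union>\<F>"
    using C unfolding compactin_def by (metis (no_types, lifting) mem_Collect_eq)
  have "{n. s n \<in> \<Union>\<F>} = (\<Union>U\<in>\<F>. {n. s n \<in> U})" by blast
  then have "finite {n. s n \<in> \<Union>\<F>}" using \<F> by auto
  moreover have "openin X (\<Union>\<F>)" using \<F> by blast
  ultimately show thesis using that \<F> by blast
qed

lemma compact_space_cluster_point:
  assumes "compact_space X" "range s \<subseteq> topspace X"
  obtains g where "g \<in> topspace X" "\<And>U. openin X U \<Longrightarrow> g \<in> U \<Longrightarrow> infinite {n :: nat. s n \<in> U}"
proof (rule ccontr)
  note obt = that
  assume "\<not> thesis"
  then have "\<exists>U. openin X U \<and> z \<in> U \<and> finite {n. s n \<in> U}" if "z \<in> topspace X" for z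
    using obt[OF that] by blast
  then obtain U where "openin X U" "topspace X \<subseteq> U" "finite {n. s n \<in> U}"
    using compactin_cluster_point[of X "topspace X" s] assms(1) unfolding compact_space_def by blast
  moreover from this have "{n. s n \<in> U} = UNIV" using assms(2) by blast
  ultimately show False by simp
qed

lemma countably_compact_if_cluster_points:
  assumes cluster: "\<And>s :: nat \<Rightarrow> 'a. range s \<subseteq> topspace X \<Longrightarrow>
      \<exists>g\<in>topspace X. \<forall>U. openin X U \<and> g \<in> U \<longrightarrow> infinite {n. s n \<in> U}"
  shows "countably_compact_space X"
  unfolding countably_compact_space_def
proof (intro allI impI, elim conjE)
  fix \<U> assume \<U>: "countable \<U>" "\<forall>U\<in>\<U>. openin X U" "topspace X \<subseteq> \<Union>\<U>"
  show "\<exists>\<F>. finite \<F> \<and> \<F> \<subseteq> \<U> \<and> topspace X \<subseteq> \<Union>\<F>"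
  proof (rule ccontr)
    assume no: "\<not> ?thesis"
    then have ne: "\<U> \<noteq> {}" using \<U>(3) by blast
    define u where "u = from_nat_into \<U>"
    have u: "range u = \<U>" unfolding u_def using range_from_nat_into[OF ne \<U>(1)] .
    \<comment> \<open>Without a finite subcover there are points outside the first n + 1 members of
      the cover; a sequence of such points leaves every member for good, so it cannot
      cluster.\<close>
    have "\<exists>d. d \<in> topspace X \<and> (\<forall>k\<le>n. d \<notin> u k)" for n
    proof (rule ccontr)
      assume "\<not> ?thesis"
      then have "topspace X \<subseteq> \<Union>(u ` {..n})" by auto
      then show False using no u by (metis finite_atMost finite_imageI image_mono subset_UNIV)
    qed
    then obtain d where d: "\<And>n. d n \<in> topspace X" "\<And>n k. k \<le> n \<Longrightarrow> d n \<notin> u k" by metis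
    have "range d \<subseteq> topspace X" using d(1) by blast
    then obtain g where g: "g \<in> topspace X" "\<And>U. openin X U \<Longrightarrow> g \<in> U \<Longrightarrow> infinite {n. d n \<in> U}"
      using cluster by meson
    obtain k where k: "g \<in> u k" using g(1) \<U>(3) u by blast
    then have "infinite {n. d n \<in> u k}" using g(2) u \<U>(2) by blast
    moreover have "{n. d n \<in> u k} \<subseteq> {..<k}" using d(2) by (auto simp: not_less[symmetric])
    ultimately show False using finite_subset by blast
  qed
qed

section \<open>Countably compact dense subgroups with small quotients\<close>

context topological_group
begin

lemma continuum_intersection_open:
  assumes "openin T U"
  shows "continuum_intersection U"
  unfolding continuum_intersection_def using assms by (intro exI[of _ "\<lambda>r. U"]) auto

text \<open>Basic neighbourhoods of the neutral element of D/N pull back to traces on D of open sets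
  O' of G, at most c many. Their intersection in G is N: given x outside N, some open W0 around N
  has a closure omitting x, and some O' has its trace inside W0. As D is dense, that O' lies in the
  closure of W0 and omits x.\<close>

lemma continuum_intersection_of_weight_quotient:
  assumes T: "compact_space T" and D: "subgroup D G" "dense_in T D" and N: "closed_normal N" "N \<subseteq> D"
    and w: "weight (quotient_topology (subtopology T D) (\<lambda>x. N #>\<^bsub>G\<lparr>carrier := D\<rparr>\<^esub> x)) \<le>o |UNIV :: real set|"
  shows "continuum_intersection N"
proof -
  let ?D = "G\<lparr>carrier := D\<rparr>"
  let ?S = "quotient_topology (subtopology T D) (\<lambda>x. N #> x)"
  interpret D: topological_group ?D "subtopology T D" using topological_group_subgroup[OF D(1)] .
  have DG: "D \<subseteq> carrier G" using D(1) subgroup.subset by blast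
  note N' = closed_normal_subgroup[OF N(1)]
  have normal: "x \<otimes> h \<otimes> inv x \<in> N" if "x \<in> carrier G" "h \<in> N" for x h
    using N(1) that unfolding closed_normal_def normal_inv_iff by blast
  have topD: "topspace (subtopology T D) = D" using DG by (auto simp: topspace_eq)
  have "closedin (subtopology T D) N"
    using N N'(4) by (auto simp: closedin_subtopology)
  then have cnD: "D.closed_normal N"
    using normal_restrict_supergroup[OF D(1) _ N(2)] N(1) by (simp add: D.closed_normal_def closed_normal_def)
  obtain \<B> where \<B>: "is_base ?S \<B>" "|\<B>| \<le>o |UNIV :: real set|"
    using weight_attained[of ?S] w by auto
  have "\<exists>O'. openin T O' \<and> {x \<in> D. N #> x \<in> B} = O' \<inter> D" if "B \<in> \<B>" for B
  proof -
    have "openin ?S B" using \<B>(1) that unfolding is_base_def by blast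
    then have "openin (subtopology T D) {x \<in> D. N #> x \<in> B}"
      unfolding openin_quotient_topology topD by blast
    then show ?thesis by (auto simp: openin_subtopology)
  qed
  then obtain O' where O': "\<And>B. B \<in> \<B> \<Longrightarrow> openin T (O' B)"
    "\<And>B. B \<in> \<B> \<Longrightarrow> {x \<in> D. N #> x \<in> B} = O' B \<inter> D" by metis
  let ?\<B> = "{B \<in> \<B>. N \<in> B}"
  have coset_N: "N #> n = N" if "n \<in> N" for n
    using coset_join2[OF _ N'(1) that] that N'(2) by blast
  have NS: "N \<in> topspace ?S"
    unfolding topspace_quotient_topology topD using coset_N[OF N'(3)] N(2) N'(3) by blast
  have "(\<Inter>B\<in>?\<B>. O' B) = N"
  proof
    show "N \<subseteq> (\<Inter>B\<in>?\<B>. O' B)"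
    proof (intro INT_greatest subsetI)
      fix B n assume B: "B \<in> ?\<B>" and n: "n \<in> N"
      then have "n \<in> {x \<in> D. N #> x \<in> B}" using coset_N N(2) by auto
      then show "n \<in> O' B" using O'(2) B by blast
    qed
    show "(\<Inter>B\<in>?\<B>. O' B) \<subseteq> N"
    proof (intro subsetI, rule ccontr)
      fix x assume x: "x \<in> (\<Inter>B\<in>?\<B>. O' B)" and xN: "x \<notin> N"
      have norm: "normal_space T"
        using T Hausdorff compact_Hausdorff_or_regular_imp_normal_space by blast
      have "openin T (topspace T - {x})" using Hausdorff by (intro open_in_Hausdorff_delete) auto
      moreover have "N \<subseteq> topspace T - {x}" using xN N'(2) by (auto simp: topspace_eq)
      ultimately obtain W0 where W0: "openin T W0" "N \<subseteq> W0" "T closure_of W0 \<subseteq> topspace T - {x}"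
        using norm[unfolded normal_space_alt, rule_format, of N "topspace T - {x}"] N'(4) by blast
      obtain V where V: "openin T V" "\<one> \<in> V" "\<And>v c. v \<in> V \<Longrightarrow> c \<in> N \<Longrightarrow> v \<otimes> c \<in> W0"
        using nbhd_mult_closed[OF T N'(4) W0(1,2)] by metis
      have VG: "V \<subseteq> carrier G" using V openin_subset_carrier by blast
      \<comment> \<open>W = N V is a union of cosets of N, so its image in the quotient pulls back
        to nothing larger. It still lies in W0 because N V = V N by normality.\<close>
      define W where "W = (\<Union>n\<in>N. n <# V)"
      have oW: "openin T W" unfolding W_def using V(1) N'(2) openin_l_coset by blast
      have WW0: "W \<subseteq> W0"
      proof
        fix u assume "u \<in> W"
        then obtain n v where nv: "n \<in> N" "v \<in> V" "u = n \<otimes> v" by (auto simp: W_def l_coset_def)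
        then have c: "n \<in> carrier G" "v \<in> carrier G" using N' VG by auto
        have "inv v \<otimes> n \<otimes> inv (inv v) \<in> N" using nv c by (intro normal) auto
        then have "v \<otimes> (inv v \<otimes> n \<otimes> v) \<in> W0" using V(3) nv c by simp
        then show "u \<in> W0" using nv c by (simp add: m_assoc[symmetric])
      qed
      have oWD: "openin (subtopology T D) (W \<inter> D)" using oW by (auto simp: openin_subtopology)
      let ?\<W> = "(\<lambda>x. N #> x) ` (W \<inter> D)"
      have "openin ?S ?\<W>" using D.openin_quotient_image[OF cnD oWD] by simp
      moreover have "\<one> \<in> W" using N'(3) V(2) unfolding W_def l_coset_def by force
      then have "N \<in> ?\<W>" using coset_N[OF N'(3)] N(2) N'(3) by blast
      ultimately obtain B where B: "B \<in> \<B>" "N \<in> B" "B \<subseteq> ?\<W>"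
        using \<B>(1) unfolding is_base_def by meson
      have sub: "O' B \<inter> D \<subseteq> W"
      proof
        fix u assume "u \<in> O' B \<inter> D"
        then have "u \<in> D" "N #> u \<in> B" using O'(2)[OF B(1)] by blast+
        then obtain v where v: "v \<in> W" "v \<in> D" "N #> u = N #> v" using B(3) by blast
        have uv: "u \<in> carrier G" "v \<in> carrier G" using \<open>u \<in> D\<close> v DG by auto
        then have m: "u \<otimes> inv v \<in> N" using v r_coset_eq_iff[OF N(1)] by blast
        obtain n a where na: "n \<in> N" "a \<in> V" "v = n \<otimes> a" using v by (auto simp: W_def l_coset_def)
        have c: "n \<in> carrier G" "a \<in> carrier G" using na N' VG by auto
        have "u = (u \<otimes> inv v) \<otimes> v" using uv by (simp add: m_assoc)
        then have "u = ((u \<otimes> inv v) \<otimes> n) \<otimes> a" using na c uv by (metis inv_closed m_assoc m_closed)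
        moreover have "(u \<otimes> inv v) \<otimes> n \<in> N" using m na(1) N'(1) by (simp add: subgroup.m_closed)
        ultimately show "u \<in> W" using na(2) unfolding W_def l_coset_def by blast
      qed
      have xO: "x \<in> O' B" using x B by blast
      have xT: "x \<in> topspace T" using xO O'(1)[OF B(1)] openin_subset by blast
      have "x \<in> T closure_of W0"
        unfolding in_closure_of
      proof (intro conjI allI impI xT)
        fix U assume U: "x \<in> U \<and> openin T U"
        have "x \<in> T closure_of D" using D(2) xT by (simp add: dense_in_def)
        moreover have "openin T (U \<inter> O' B)" using U O'(1)[OF B(1)] by blast
        moreover have "x \<in> U \<inter> O' B" using U xO by blast
        ultimately obtain d where "d \<in> D" "d \<in> U \<inter> O' B" by (rule closure_of_meets)
        then show "\<exists>y. y \<in> W0 \<and> y \<in> U" using sub WW0 by blast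
      qed
      then show False using W0(3) by blast
    qed
  qed
  moreover have "?\<B> \<noteq> {}" using \<B>(1) NS unfolding is_base_def by blast
  moreover have "|?\<B>| \<le>o |UNIV :: real set|"
    using card_of_mono1[of ?\<B> \<B>] \<B>(2) ordLeq_transitive by blast
  ultimately show ?thesis
    using continuum_intersection_INT[of ?\<B> O'] O'(1) continuum_intersection_open by auto
qed

lemma subgroup_set_mult_normal:
  assumes Y: "Y \<subseteq> carrier G" "Y \<noteq> {}" "\<And>x y. x \<in> Y \<Longrightarrow> y \<in> Y \<Longrightarrow> x \<otimes> y \<in> Y" "\<And>x. x \<in> Y \<Longrightarrow> inv x \<in> Y"
    and N: "N \<lhd> G"
  shows "subgroup (Y <#> N) G"
proof -
  have YG: "subgroup Y G" using Y by (intro subgroupI) auto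
  have NG: "subgroup N G" using N normal_imp_subgroup by blast
  have comm: "N <#> Y = Y <#> N" using commut_normal[OF YG N] by simp
  have c: "Y <#> N \<subseteq> carrier G" using setmult_subset_G Y(1) subgroup.subset[OF NG] by blast
  show ?thesis
  proof (rule subgroupI)
    show "Y <#> N \<noteq> {}" using Y(2) subgroup.one_closed[OF NG] by (auto simp: set_mult_def)
    fix a assume "a \<in> Y <#> N"
    then obtain y n where yn: "y \<in> Y" "n \<in> N" "a = y \<otimes> n" by (auto simp: set_mult_def)
    then have "inv a = inv n \<otimes> inv y" using Y(1) subgroup.subset[OF NG] by (simp add: inv_mult_group subset_iff)
    moreover have "inv n \<in> N" "inv y \<in> Y" using yn Y(4) NG by (auto simp: subgroup.m_inv_closed)
    ultimately have "inv a \<in> N <#> Y" unfolding set_mult_def by blast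
    then show "inv a \<in> Y <#> N" using comm by simp
    fix b assume "b \<in> Y <#> N"
    then have "a \<otimes> b \<in> (Y <#> N) <#> (Y <#> N)" using \<open>a \<in> Y <#> N\<close> unfolding set_mult_def by blast
    also have "(Y <#> N) <#> (Y <#> N) = Y <#> (N <#> Y) <#> N"
      using Y(1) subgroup.subset[OF NG] c by (simp add: set_mult_assoc setmult_subset_G)
    also have "\<dots> = (Y <#> Y) <#> (N <#> N)"
      unfolding comm using Y(1) subgroup.subset[OF NG] c by (simp add: set_mult_assoc setmult_subset_G)
    also have "\<dots> = Y <#> N" using subgroup_mult_id YG NG by simp
    finally show "a \<otimes> b \<in> Y <#> N" .
  qed (use c in blast)
qed

text \<open>Compactness of \<open>N\<close> lets cluster points of sequences in \<open>Y\<close> be corrected to cluster points of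
  sequences in \<open>Y N\<close>, so that only continuum many of them have to be added to \<open>Y\<close>.\<close>

theorem exists_countably_compact_not_projectively_arhangelskii:
  assumes T: "compact_space T" and w: "\<not> weight T \<le>o |UNIV :: real set|"
  obtains D where "subgroup D G" "dense_in T D" "countably_compact_space (subtopology T D)"
    "\<not> projectively_arhangelskii (G\<lparr>carrier := D\<rparr>) (subtopology T D)"
proof -
  obtain N x where N: "closed_normal N" "\<not> continuum_intersection N"
    and x: "\<And>j. x j \<in> carrier G" "dense_family N x" using exists_dense_family[OF T w] by metis
  note N' = closed_normal_subgroup[OF N(1)]
  have Nn: "N \<lhd> G" using N(1) by (simp add: closed_normal_def)
  have "\<exists>g\<in>carrier G. \<forall>U. openin T U \<and> g \<in> U \<longrightarrow> infinite {n. s n \<in> U}"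
    if "range s \<subseteq> carrier G" for s :: "nat \<Rightarrow> 'a"
    using compact_space_cluster_point[OF T, of s] that unfolding topspace_eq by metis
  then obtain cl where cl: "\<And>s :: nat \<Rightarrow> 'a. range s \<subseteq> carrier G \<Longrightarrow> cl s \<in> carrier G"
    "\<And>(s :: nat \<Rightarrow> 'a) U. range s \<subseteq> carrier G \<Longrightarrow> openin T U \<Longrightarrow> cl s \<in> U \<Longrightarrow> infinite {n. s n \<in> U}" by metis
  \<comment> \<open>The group operations are written as operations on sequences that read only the
    first terms, to share the countable arity of the choice of cluster points.\<close>
  define op where "op n s = (if n = 0 then s 0 \<otimes> s 1 else if n = 1 then inv (s 0) else cl s)"
    for n :: nat and s :: "nat \<Rightarrow> 'a"
  have opG: "op n s \<in> carrier G" if "range s \<subseteq> carrier G" for n s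
  proof -
    have "s k \<in> carrier G" for k using that by blast
    then show ?thesis using cl(1)[OF that] by (simp add: op_def)
  qed
  have xG: "range x \<subseteq> carrier G" using x(1) by blast
  obtain Y where Y: "|Y| \<le>o |UNIV :: real set|" "range x \<subseteq> Y" "Y \<subseteq> carrier G"
    "\<And>n s. range s \<subseteq> Y \<Longrightarrow> op n s \<in> Y" using countable_operations_hull[of x "carrier G" op] xG opG by metis
  have Ymult: "a \<otimes> b \<in> Y" if "a \<in> Y" "b \<in> Y" for a b
    using Y(4)[of "\<lambda>k. if k = 0 then a else b" 0] that by (auto simp: op_def)
  have Yinv: "inv a \<in> Y" if "a \<in> Y" for a
    using Y(4)[of "\<lambda>k. a" 1] that by (auto simp: op_def)
  have Ycl: "cl s \<in> Y" if "range s \<subseteq> Y" for s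
    using Y(4)[OF that, of 2] by (simp add: op_def)
  have Yne: "Y \<noteq> {}" using Y(2) by blast
  define D where "D = Y <#> N"
  have D: "subgroup D G"
    unfolding D_def using Y(3) Yne Ymult Yinv Nn by (intro subgroup_set_mult_normal)
  have DG: "D \<subseteq> carrier G" using D subgroup.subset by blast
  have YG: "subgroup Y G" using Y(3) Yne Ymult Yinv by (intro subgroupI) auto
  have comm: "D = N <#> Y" unfolding D_def using commut_normal[OF YG Nn] .
  have topD: "topspace (subtopology T D) = D" using DG by (auto simp: topspace_eq)
  have ND: "N \<subseteq> D"
  proof
    fix n assume "n \<in> N"
    moreover have "n = \<one> \<otimes> n" using \<open>n \<in> N\<close> N'(2) by auto
    ultimately show "n \<in> D" using subgroup.one_closed[OF YG] unfolding D_def set_mult_def by blast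
  qed
  have YD: "Y \<subseteq> D"
  proof
    fix y assume "y \<in> Y"
    moreover have "y = y \<otimes> \<one>" using \<open>y \<in> Y\<close> Y(3) by auto
    ultimately show "y \<in> D" using N'(3) unfolding D_def set_mult_def by blast
  qed
  have dense: "dense_in T D"
    unfolding dense_in_def
  proof (intro conjI equalityI closure_of_subset_topspace subsetI)
    show "g \<in> topspace T" if "g \<in> D" for g using that DG topspace_eq by blast
    fix g assume g: "g \<in> topspace T"
    show "g \<in> T closure_of D"
      unfolding in_closure_of
    proof (intro conjI allI impI g)
      fix U assume U: "g \<in> U \<and> openin T U"
      then have UG: "U \<subseteq> carrier G" using openin_subset_carrier by blast
      have "openin T (U <#> N)" using U N'(2) openin_set_mult_right by blast
      moreover have "g <# N \<subseteq> U <#> N" using U by (auto simp: l_coset_def set_mult_def)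
      ultimately have "|UNIV :: real set| \<le>o |{j. x j <# N \<subseteq> U <#> N}|"
        using x(2) g unfolding dense_family_def topspace_eq by blast
      \<comment> \<open>One witness suffices here: if x_j N lies in U N, then x_j N meets U, and x_j
        N is part of D.\<close>
      then have "infinite {j. x j <# N \<subseteq> U <#> N}"
        using card_of_ordLeq_finite infinite_UNIV_char_0 by blast
      then obtain j where "x j <# N \<subseteq> U <#> N" using not_finite_existsD by blast
      then have "x j \<in> U <#> N" using mem_l_coset_self[OF N'(3) x(1)] by blast
      then obtain u n where un: "u \<in> U" "n \<in> N" "x j = u \<otimes> n" by (auto simp: set_mult_def)
      then have "u = x j \<otimes> inv n" using UG N'(2) by (simp add: m_assoc subset_iff)
      moreover have "x j \<in> Y" "inv n \<in> N" using Y(2) un(2) N'(1) by (blast intro: subgroup.m_inv_closed)+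
      ultimately have "u \<in> D" unfolding D_def set_mult_def by blast
      then show "\<exists>y. y \<in> D \<and> y \<in> U" using un by blast
    qed
  qed
  have cc: "countably_compact_space (subtopology T D)"
  proof (rule countably_compact_if_cluster_points)
    fix s :: "nat \<Rightarrow> 'a" assume "range s \<subseteq> topspace (subtopology T D)"
    then have sD: "s k \<in> D" for k unfolding topD by blast
    then have "\<exists>a n. a \<in> Y \<and> n \<in> N \<and> s k = a \<otimes> n" for k
      using sD[of k] unfolding D_def set_mult_def by blast
    then obtain a m where am: "\<And>k. a k \<in> Y" "\<And>k. m k \<in> N" "\<And>k. s k = a k \<otimes> m k" by metis
    have aY: "range a \<subseteq> Y" using am by blast
    then have aG: "range a \<subseteq> carrier G" using Y(3) by blast
    let ?g = "cl a"
    have g: "?g \<in> Y" "?g \<in> carrier G" using Ycl[OF aY] cl(1)[OF aG] by auto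
    have clgN: "closedin T (?g <# N)" using closedin_l_coset[OF N'(4) g(2)] .
    \<comment> \<open>The cluster point g of the a_n need not be one of the s_n = a_n m_n, but some
      point of g N is: an open set around g N contains V g N for a neighbourhood V of 1, hence it
      contains s_n whenever a_n lies in V g.\<close>
    have "\<exists>z\<in>?g <# N. \<forall>U. openin T U \<and> z \<in> U \<longrightarrow> infinite {n. s n \<in> U}"
    proof (rule ccontr)
      assume no: "\<not> ?thesis"
      have "compactin T (?g <# N)" using clgN T closedin_compact_space by blast
      then obtain O' where O': "openin T O'" "?g <# N \<subseteq> O'" "finite {n. s n \<in> O'}"
        by (rule compactin_cluster_point[of T "?g <# N" s]) (use no in blast)
      obtain V where V: "openin T V" "\<one> \<in> V" "\<And>v c. v \<in> V \<Longrightarrow> c \<in> ?g <# N \<Longrightarrow> v \<otimes> c \<in> O'"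
        using nbhd_mult_closed[OF T clgN O'(1,2)] by metis
      have VG: "V \<subseteq> carrier G" using V openin_subset_carrier by blast
      have "openin T (V #> ?g)" using openin_r_coset[OF V(1) g(2)] .
      moreover have "?g \<in> V #> ?g" using V(2) g(2) by (simp add: r_coset_eq_vimage[OF VG])
      ultimately have inf: "infinite {n. a n \<in> V #> ?g}" using cl(2)[OF aG] by blast
      have "{n. a n \<in> V #> ?g} \<subseteq> {n. s n \<in> O'}"
      proof clarify
        fix n assume "a n \<in> V #> ?g"
        then obtain v where v: "v \<in> V" "a n = v \<otimes> ?g" by (auto simp: r_coset_def)
        have "?g \<otimes> m n \<in> ?g <# N" using am(2) by (auto simp: l_coset_def)
        then have "v \<otimes> (?g \<otimes> m n) \<in> O'" using V(3) v by blast
        moreover have "v \<in> carrier G" "m n \<in> carrier G" using v VG am(2)[of n] N'(2) by auto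
        ultimately show "s n \<in> O'" using am(3)[of n] v g(2) by (simp add: m_assoc)
      qed
      then show False using inf O'(3) finite_subset by blast
    qed
    then obtain z where z: "z \<in> ?g <# N" "\<And>U. openin T U \<Longrightarrow> z \<in> U \<Longrightarrow> infinite {n. s n \<in> U}" by blast
    have zD: "z \<in> D" using z(1) g(1) by (auto simp: D_def l_coset_def set_mult_def)
    show "\<exists>g\<in>topspace (subtopology T D). \<forall>U. openin (subtopology T D) U \<and> g \<in> U \<longrightarrow> infinite {n. s n \<in> U}"
    proof (intro bexI[of _ z] allI impI, elim conjE)
      fix U assume "openin (subtopology T D) U" "z \<in> U"
      then obtain W where W: "openin T W" "U = W \<inter> D" by (auto simp: openin_subtopology)
      then have "{n. s n \<in> U} = {n. s n \<in> W}" using sD by blast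
      then show "infinite {n. s n \<in> U}" using z(2)[OF W(1)] W \<open>z \<in> U\<close> by auto
    qed (use zD topD in simp)
  qed
  interpret D: topological_group "G\<lparr>carrier := D\<rparr>" "subtopology T D" using topological_group_subgroup[OF D] .
  have "closedin (subtopology T D) N" using ND N'(4) by (auto simp: closedin_subtopology)
  then have cnD: "D.closed_normal N"
    using normal_restrict_supergroup[OF D Nn ND] by (simp add: D.closed_normal_def)
  let ?q = "\<lambda>x. N #>\<^bsub>G\<lparr>carrier := D\<rparr>\<^esub> x"
  let ?S = "quotient_topology (subtopology T D) ?q"
  have "\<not> projectively_arhangelskii (G\<lparr>carrier := D\<rparr>) (subtopology T D)"
  proof
    assume "projectively_arhangelskii (G\<lparr>carrier := D\<rparr>) (subtopology T D)"
    then have "arhangelskii ?S"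
      using projectively_arhangelskiiD[OF _ D.topological_group_Mod[OF cnD] D.epi_Mod[OF cnD]
          continuous_map_quotient_topology] by blast
    then have "weight ?S \<le>o |topspace ?S|" by (simp add: arhangelskii_def)
    \<comment> \<open>Every coset of N in D has a representative in Y, so the quotient has at most c
      points.\<close>
    also have "topspace ?S = ?q ` Y"
    proof -
      have "?q d \<in> ?q ` Y" if d: "d \<in> D" for d
      proof -
        obtain n y where ny: "n \<in> N" "y \<in> Y" "d = n \<otimes> y" using d unfolding comm set_mult_def by blast
        then have c: "n \<in> carrier G" "y \<in> carrier G" using N'(2) Y(3) by auto
        then have "d \<otimes> inv y = n" using ny by (simp add: m_assoc)
        then have "N #> d = N #> y" using r_coset_eq_iff[OF N(1), of d y] ny c by simp
        then show ?thesis using ny by simp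
      qed
      then show ?thesis using YD unfolding topspace_quotient_topology topD by blast
    qed
    also have "|?q ` Y| \<le>o |Y|" by (rule card_of_image)
    also have "|Y| \<le>o |UNIV :: real set|" by (rule Y(1))
    finally have "weight ?S \<le>o |UNIV :: real set|" .
    then show False using continuum_intersection_of_weight_quotient[OF T D dense N(1) ND] N(2) by blast
  qed
  then show thesis using that D dense cc by blast
qed

end

theorem theorem4p4:
  fixes G :: "('a, 'm) monoid_scheme" and T :: "'a topology"
  assumes "topological_group G T" and "compact_space T"
  shows
    "((\<forall>D. subgroup D G \<and> gdelta_dense_in T D \<longrightarrow>
         projectively_arhangelskii (G\<lparr>carrier := D\<rparr>) (subtopology T D))
      \<longleftrightarrow> weight T \<le>o |UNIV :: real set| )
     \<and>
     ((\<forall>D. subgroup D G \<and> dense_in T D \<and> pseudocompact_space (subtopology T D) \<longrightarrow>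
         projectively_arhangelskii (G\<lparr>carrier := D\<rparr>) (subtopology T D))
      \<longleftrightarrow> weight T \<le>o |UNIV :: real set| )
     \<and>
     ((\<forall>D. subgroup D G \<and> dense_in T D \<and> countably_compact_space (subtopology T D) \<longrightarrow>
         projectively_arhangelskii (G\<lparr>carrier := D\<rparr>) (subtopology T D))
      \<longleftrightarrow> weight T \<le>o |UNIV :: real set| )"
proof -
  interpret topological_group G T by fact
  have pc: "pseudocompact_space (subtopology T D)" if "countably_compact_space (subtopology T D)" for D
    using countably_compact_imp_pseudocompact that .
  have gd: "gdelta_dense_in T D" if "dense_in T D" "pseudocompact_space (subtopology T D)" for D
    using pseudocompact_dense_imp_gdelta_dense[OF assms(2) Hausdorff] that .
  show ?thesis
  proof (cases "weight T \<le>o |UNIV :: real set|")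
    case True
    have "projectively_arhangelskii (G\<lparr>carrier := D\<rparr>) (subtopology T D)"
      if "subgroup D G" "gdelta_dense_in T D" for D
      using gdelta_dense_imp_projectively_arhangelskii[OF assms(2) that True] .
    then show ?thesis using True pc gd by blast
  next
    case False
    then obtain D where D: "subgroup D G" "dense_in T D" "countably_compact_space (subtopology T D)"
      "\<not> projectively_arhangelskii (G\<lparr>carrier := D\<rparr>) (subtopology T D)"
      using exists_countably_compact_not_projectively_arhangelskii[OF assms(2)] by metis
    then show ?thesis using False pc[OF D(3)] gd[OF D(2) pc[OF D(3)]] by blast
  qed
qed

end
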